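(* Let $d,m,n,N\ge 1$ be integers and $\mu>0$. Let $F=\sum_{i=1}^n f_i:\mathbb{R}^{d\times m}\to\mathbb{R}$, where the $f_i$ are differentiable with Lipschitz-continuous gradient, and suppose $F$ is convex and differentiable, has curvature constant $C_F>0$ over $\mathcal{D}=\{W\in\mathbb{R}^{d\times m}:\|W\|_*\le\mu\}$, and is Lipschitz with constant $L>0$ with respect to the trace norm, i.e. $|F(W)-F(W')|\le L\|W-W'\|_*$ for all $W,W'$. Let $W^*\in\mathcal{D}$ be a minimizer of $F$ over $\mathcal{D}$, and let $\delta>0$ be an accuracy parameter. Let $(W^t)_{t\ge0}$ be the random iterates produced by the algorithm DFW-Trace (described in the context) with an arbitrary initial point $W^0\in\mathcal{D}$ and with $K(t)\in\mathbb{N}$ power iterations at epoch $t$, with either of its two step-size rules. 1. If $m\ge 8$ and, for every $t\ge 0$, $$K(t)\ \ge\ 1+\left\lceil\frac{\mu L (t+2)\ln m}{\delta C_F}\right\rceil,$$ then DFW-Trace converges sublinearly in expectation, i.e. $$\mathbb{E}[F(W^t)]-F(W^* )\ \le\ \frac{2C_F}{t+2}(1+\delta)\qquad\text{for every } t\ge1.$$ 2. Let $\sigma_1^t$ and $\sigma_2^t$ be the largest and second largest singular values of $\nabla F(W^t)$. Let $\beta<1$ be a constant. There is a constant $\widetilde K$, independent of $t$ and of the choice of the sequence $K(\cdot)$, such that the following holds. If for every $t\ge 0$ (almost surely along the run of the algorithm) $\sigma_1^t$ has multiplicity $1$ and $\sigma_2^t/\sigma_1^t<\beta$, and if for every $t\ge0$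 $$K(t)\ \ge\ \max\left(\left\lceil\frac{\ln(\delta C_F)-\ln[m\mu L(t+2)]}{2\ln\beta}\right\rceil+1,\ \widetilde K\right),$$ then DFW-Trace converges sublinearly in expectation, i.e. $\mathbb{E}[F(W^t)]-F(W^* )\le\frac{2C_F}{t+2}(1+\delta)$ for every $t\ge1$.
   Context: Notation: $\|W\|_*$ is the trace (nuclear) norm, the sum of the singular values of $W$; $\langle A,B\rangle=\mathrm{tr}(A^\top B)$; $\|\cdot\|$ on vectors is the Euclidean norm. When $\min(d,m)=1$ the second largest singular value is taken to be $0$. The problem is to minimize $F(W)=\sum_{i=1}^n f_i(W)$ over $\mathcal{D}=\{W\in\mathbb{R}^{d\times m}:\|W\|_*\le\mu\}$. Curvature constant of $F$ over $\mathcal{D}$: $$C_F=\sup_{\substack{X,S\in\mathcal{D},\ \gamma\in(0,1]\\ Y=X+\gamma(S-X)}}\frac{2}{\gamma^2}\big(F(Y)-F(X)-\langle Y-X,\nabla F(X)\rangle\big),$$ assumed finite. Algorithm DFW-Trace. The index set $\{1,\dots,n\}$ is partitioned into $I_1,\dots,I_N$ (one part for each of $N$ workers), and $F_j=\sum_{i\in I_j}f_i$, so $F=\sum_{j=1}^N F_j$. Start from $W^0\in\mathcal{D}$. At each epoch $t=0,1,2,\dots$: (i) draw $v_0\in\mathbb{R}^m$ uniformly on the unit sphere, independently of everything drawn before (all workers share the same $v_0$); (ii) for $k=0,\dots,K(t)-1$, set $$u_{k+1}=\frac{\sum_{j=1}^N\nabla F_j(W^t)v_k}{\big\|\sum_{j=1}^N\nabla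 F_j(W^t)v_k\big\|},\qquad v_{k+1}=\frac{\sum_{j=1}^N\nabla F_j(W^t)^\top u_{k+1}}{\big\|\sum_{j=1}^N\nabla F_j(W^t)^\top u_{k+1}\big\|}$$ (if a vector to be normalized is zero, the normalized vector is an arbitrary unit vector); (iii) set $W^{t+1}=(1-\gamma^t)W^t-\gamma^t\mu\,u_{K(t)}v_{K(t)}^\top$, where the step size is either $\gamma^t=\frac{2}{t+2}$ for all $t$, or is determined by line search, i.e. $\gamma^t\in\arg\min_{\gamma\in[0,1]}F\big((1-\gamma)W^t-\gamma\mu\,u_{K(t)}v_{K(t)}^\top\big)$. The numbers $K(t)$ are deterministic. Expectation is over the random vectors $v_0$ drawn at all epochs. *)

theory Defs
  imports "HOL-Probability.Probability"
begin

section \<open>Singular values and the trace norm\<close>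

text \<open>
  A real matrix with \<open>d\<close> rows and \<open>m\<close> columns has type \<^typ>\<open>real^'m^'d\<close>.
  It has \<open>min d m\<close> singular values, counted with multiplicity: the positive ones are the
  square roots of the positive eigenvalues of \<open>A\<^sup>T A\<close> (whose algebraic and geometric multiplicities
  agree, the matrix being symmetric), and \<open>0\<close> fills up the remaining \<open>min d m - rank A\<close> places.
\<close>

definition sv_mult :: "real^'m^'d \<Rightarrow> real \<Rightarrow> nat" where
  "sv_mult A s =
     (if s > 0 then dim {x. (transpose A ** A) *v x = s\<^sup>2 *\<^sub>R x}
      else if s = 0 then min CARD('d) CARD('m) - rank A
      else 0)"

definition singular_values :: "real^'m^'d \<Rightarrow> real multiset" where
  "singular_values A = (\<Sum>s | sv_mult A s > 0. replicate_mset (sv_mult A s) s)"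

text \<open>The sum defining \<^const>\<open>singular_values\<close> is over a finite set.\<close>

lemma finite_sv_mult: "finite {s. sv_mult A s > 0}"
  for A :: "real^'m^'d"
proof -
  define B where "B = transpose A ** A"
  define P where "P = {s. s > 0 \<and> sv_mult A s > 0}"
  have "\<exists>x. x \<noteq> 0 \<and> B *v x = s\<^sup>2 *\<^sub>R x" if "s \<in> P" for s
  proof (rule ccontr)
    assume "\<not> ?thesis"
    hence "{x. B *v x = s\<^sup>2 *\<^sub>R x} \<subseteq> {0}" by auto
    hence "dim {x. B *v x = s\<^sup>2 *\<^sub>R x} = 0" using dim_subset[of _ "{0::real^'m}"] by fastforce
    moreover have "dim {x. B *v x = s\<^sup>2 *\<^sub>R x} > 0"
      using that by (simp add: P_def sv_mult_def B_def split: if_splits)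
    ultimately show False by linarith
  qed
  then obtain e where e: "\<And>s. s \<in> P \<Longrightarrow> e s \<noteq> 0 \<and> B *v e s = s\<^sup>2 *\<^sub>R e s"
    by metis
  have sym: "(B *v x) \<bullet> y = x \<bullet> (B *v y)" for x y
    by (metis B_def dot_lmul_matrix matrix_transpose_mul transpose_matrix_vector transpose_transpose)
  have orth: "e s \<bullet> e r = 0" if "s \<in> P" "r \<in> P" "s \<noteq> r" for s r
  proof -
    have "s\<^sup>2 * (e s \<bullet> e r) = r\<^sup>2 * (e s \<bullet> e r)"
      using sym[of "e s" "e r"] e that by simp
    moreover have "s\<^sup>2 \<noteq> r\<^sup>2" using that by (auto simp: P_def power2_eq_iff)
    ultimately show ?thesis by simp
  qed
  have "pairwise orthogonal (e ` P)"
    using orth by (auto simp: pairwise_def orthogonal_def)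
  moreover have "0 \<notin> e ` P" using e by force
  ultimately have "finite (e ` P)"
    using pairwise_orthogonal_independent finiteI_independent by blast
  moreover have "inj_on e P"
    using orth e by (metis inj_onI inner_eq_zero_iff)
  ultimately have "finite P" using finite_imageD by blast
  moreover have "{s. sv_mult A s > 0} \<subseteq> insert 0 P"
    by (auto simp: P_def sv_mult_def split: if_splits)
  ultimately show ?thesis by (meson finite.insertI finite_subset)
qed

lemma count_singular_values: "count (singular_values A) s = sv_mult A s"
proof -
  have "count (singular_values A) s = (\<Sum>r | sv_mult A r > 0. if s = r then sv_mult A r else 0)"
    unfolding singular_values_def by (simp add: count_sum eq_commute if_distrib cong: if_cong)
  thus ?thesis using finite_sv_mult[of A] by (auto simp: sum.delta')
qed

definition trace_norm :: "real^'m^'d \<Rightarrow> real" where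
  "trace_norm A = sum_mset (singular_values A)"

text \<open>\<open>sing_val A k\<close> is the \<open>k\<close>-th largest singular value (\<open>k \<ge> 1\<close>, with repetitions),
  and \<open>0\<close> if there are fewer than \<open>k\<close> of them.\<close>

definition sing_val :: "real^'m^'d \<Rightarrow> nat \<Rightarrow> real" where
  "sing_val A k = (let xs = rev (sorted_list_of_multiset (singular_values A))
                in if k \<le> length xs then xs ! (k - 1) else 0)"

definition trace_ball :: "real \<Rightarrow> (real^'m^'d) set" where
  "trace_ball \<mu> = {W. trace_norm W \<le> \<mu>}"


section \<open>Gradients and the curvature constant\<close>

text \<open>The library's inner product on matrices is the trace inner product.\<close>

lemma inner_matrix_eq_trace: "A \<bullet> B = trace (transpose A ** B)"
  for A B :: "real^'m^'d"
  unfolding trace_def matrix_matrix_mult_def transpose_def inner_vec_def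
  by (simp, rule sum.swap)

definition grad :: "(real^'m^'d \<Rightarrow> real) \<Rightarrow> real^'m^'d \<Rightarrow> real^'m^'d" where
  "grad f W = (THE D. GDERIV f W :> D)"

definition curvature_set :: "(real^'m^'d \<Rightarrow> real) \<Rightarrow> real \<Rightarrow> real set" where
  "curvature_set F \<mu> =
     {2 / \<gamma>\<^sup>2 * (F Y - F X - (Y - X) \<bullet> grad F X) | X S \<gamma> Y.
        X \<in> trace_ball \<mu> \<and> S \<in> trace_ball \<mu> \<and> 0 < \<gamma> \<and> \<gamma> \<le> 1 \<and> Y = X + \<gamma> *\<^sub>R (S - X)}"

definition curvature_const :: "(real^'m^'d \<Rightarrow> real) \<Rightarrow> real \<Rightarrow> real" where
  "curvature_const F \<mu> = Sup (curvature_set F \<mu>)"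


section \<open>The algorithm DFW-Trace\<close>

text \<open>Normalized surface measure on the unit sphere, as the radial projection of the
  uniform distribution on the unit ball.\<close>

definition uniform_sphere :: "'a::euclidean_space measure" where
  "uniform_sphere = distr (uniform_measure lborel (cball 0 1)) borel sgn"

definition normalizes :: "'a::real_normed_vector \<Rightarrow> 'a \<Rightarrow> bool" where
  "normalizes x y \<longleftrightarrow> norm y = 1 \<and> (x \<noteq> 0 \<longrightarrow> y = x /\<^sub>R norm x)"

definition outer :: "real^'d \<Rightarrow> real^'m \<Rightarrow> real^'m^'d" where
  "outer u v = (\<chi> i j. u $ i * v $ j)"

definition fw_step ::
    "real \<Rightarrow> real^'m^'d \<Rightarrow> real^'d \<Rightarrow> real^'m \<Rightarrow> real \<Rightarrow> real^'m^'d" where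
  "fw_step \<mu> W u v \<gamma> = (1 - \<gamma>) *\<^sub>R W - (\<gamma> * \<mu>) *\<^sub>R outer u v"

definition is_partition :: "(nat \<Rightarrow> nat set) \<Rightarrow> nat \<Rightarrow> nat \<Rightarrow> bool" where
  "is_partition I N n \<longleftrightarrow> disjoint_family_on I {1..N} \<and> (\<Union>j\<in>{1..N}. I j) = {1..n}"

definition sum_fun :: "(nat \<Rightarrow> 'a \<Rightarrow> real) \<Rightarrow> nat set \<Rightarrow> 'a \<Rightarrow> real" where
  "sum_fun f J W = (\<Sum>i\<in>J. f i W)"

text \<open>
  \<open>dfw_trace M f n I N \<mu> K W0 W\<close>: on the probability space \<open>M\<close>, the process \<open>W\<close> consists of the
  iterates of DFW-Trace for \<open>\<Sum>i=1..n. f i\<close>, with index sets \<open>I 1, \<dots>, I N\<close> and \<open>K t\<close> power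
  iterations at epoch \<open>t\<close>, started at \<open>W0\<close>.

  \<open>H t\<close> is the information available when epoch \<open>t\<close> starts. It may be larger than the one
  generated by the earlier draws, so that the arbitrary choices (normalizations of \<open>0\<close>,
  minimizers in the line search) may be made in any non-anticipating way.
  The vectors \<open>u t k\<close> and \<open>v t k\<close> are constrained only for \<open>1 \<le> k \<le> K t\<close> and
  \<open>k \<le> K t\<close>, respectively.
\<close>

definition dfw_trace ::
    "'w measure \<Rightarrow> (nat \<Rightarrow> real^'m^'d \<Rightarrow> real) \<Rightarrow> nat \<Rightarrow> (nat \<Rightarrow> nat set) \<Rightarrow> nat \<Rightarrow> real \<Rightarrow>
     (nat \<Rightarrow> nat) \<Rightarrow> real^'m^'d \<Rightarrow> (nat \<Rightarrow> 'w \<Rightarrow> real^'m^'d) \<Rightarrow> bool" where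
  "dfw_trace M f n I N \<mu> K W0 W \<longleftrightarrow>
     prob_space M \<and>
     (\<exists>(H :: nat \<Rightarrow> 'w measure) (u :: nat \<Rightarrow> nat \<Rightarrow> 'w \<Rightarrow> real^'d)
        (v :: nat \<Rightarrow> nat \<Rightarrow> 'w \<Rightarrow> real^'m) (\<gamma> :: nat \<Rightarrow> 'w \<Rightarrow> real).
        filtration (space M) H \<and>
        (\<forall>t. subalgebra M (H t)) \<and>
        (\<forall>t. W t \<in> borel_measurable (H t)) \<and>
        (\<forall>t. v t 0 \<in> borel_measurable (H (Suc t))) \<and>
        (\<forall>t. distr M borel (v t 0) = uniform_sphere) \<and>
        (\<forall>t. prob_space.indep_set M {v t 0 -` B \<inter> space M | B. B \<in> sets borel} (sets (H t))) \<and>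
        (\<forall>\<omega>\<in>space M. W 0 \<omega> = W0) \<and>
        (\<forall>\<omega>\<in>space M. \<forall>t. \<forall>k<K t.
           normalizes (\<Sum>j=1..N. grad (sum_fun f (I j)) (W t \<omega>) *v v t k \<omega>) (u t (Suc k) \<omega>) \<and>
           normalizes (\<Sum>j=1..N. transpose (grad (sum_fun f (I j)) (W t \<omega>)) *v u t (Suc k) \<omega>)
             (v t (Suc k) \<omega>)) \<and>
        (\<forall>\<omega>\<in>space M. \<forall>t.
           W (Suc t) \<omega> = fw_step \<mu> (W t \<omega>) (u t (K t) \<omega>) (v t (K t) \<omega>) (\<gamma> t \<omega>)) \<and>
        ((\<forall>\<omega>\<in>space M. \<forall>t. \<gamma> t \<omega> = 2 / (real t + 2)) \<or>
         (\<forall>\<omega>\<in>space M. \<forall>t.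
            is_arg_min
              (\<lambda>g. sum_fun f {1..n} (fw_step \<mu> (W t \<omega>) (u t (K t) \<omega>) (v t (K t) \<omega>) g))
              (\<lambda>g. g \<in> {0..1}) (\<gamma> t \<omega>))))"

end

theory Submission
  imports Defs
begin

text \<open>
  Trace norm and operator norm are dual, so the exact Frank--Wolfe direction at gradient \<open>G\<close> has
  linear value \<open>- \<mu> \<sigma>\<^sub>1(G)\<close>, and the power iterations lose \<open>\<mu> (\<sigma>\<^sub>1 - u\<^sub>K\<^sup>T G v\<^sub>K)\<close>. Convexity and the
  Lipschitz bound give \<open>\<sigma>\<^sub>1 \<le> L\<close>. If the expected loss is at most \<open>\<delta> C\<^sub>F / (t + 2)\<close> at every epoch, the
  usual Frank--Wolfe recursion yields the claim. Let \<open>b\<close> be the coordinate of the starting vector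
  along a top right singular vector.

  Without a gap, log-convexity of the norms of the power iterates gives
  \<open>u\<^sub>K\<^sup>T G v\<^sub>K \<ge> \<sigma>\<^sub>1 \<bar>b\<bar>\<^bsup>1/(2K)\<^esup>\<close>. With a gap, \<open>u\<^sub>K\<^sup>T G v\<^sub>K \<ge> \<sigma>\<^sub>1 \<bar>b\<bar> / sqrt (b\<^sup>2 + q\<^sup>2)\<close> with
  \<open>q = \<beta>\<^bsup>2K-1\<^esup>\<close>. Replacing \<open>b\<close> by the smaller coordinate of the uniform point of the ball, whose
  modulus has density at most \<open>m\<close> because the ball contains a double cone over its equator,
  the expected relative losses are at most \<open>(ln m + 1) / (2K)\<close> and \<open>m q\<close>. In the second case one power
  iteration per epoch suffices to start the argument, so \<open>1\<close> serves as the constant of part 2.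
\<close>

section \<open>Orthonormal eigenbases and the trace norm\<close>

text \<open>The tolerance is chosen to vanish like \<open>1 / (t + 2)\<close>: multiplied by the
  step size \<open>2 / (t + 2)\<close> it has the order of the curvature term, so inexact directions
  act as an additional curvature \<open>\<delta> C\<close> and produce the factor
  \<open>1 + \<delta>\<close>. The detour through the ball has a reason. The coordinate of a point
  of the sphere has an unbounded density in dimension 2 and sits at the two end points in dimension
  1, whereas the height of a point of the ball has a density bounded by its largest section in every
  dimension. Both relative losses decrease in \<open>\<bar>b\<bar>\<close>, so the smaller
  coordinate can only increase them. The exponent \<open>2 K\<close> arises because \<open>K\<close>
  rounds apply \<open>A\<close> and its transpose alternately, that is, make \<open>2 K\<close> half
  steps. The gap estimate has \<open>2 K - 1\<close> because it compares the last half step with the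
  vector reached just before it.\<close>

declare transpose_matrix_vector [simp del]

text \<open>A maximizer of the Rayleigh quotient on the compact unit sphere of \<open>S\<close> is
  an eigenvector, since moving it along its residual would otherwise increase the quotient.
  Invariant subspaces are allowed because the lemma serves the whole space, the complement of a
  partial eigenbasis and the complement of a top singular vector.\<close>

lemma selfadjoint_eigenvector:
  fixes f :: "'a::euclidean_space \<Rightarrow> 'a"
  assumes f: "linear f" and sym: "\<And>x y. f x \<bullet> y = x \<bullet> f y"
    and S: "subspace S" "\<And>x. x \<in> S \<Longrightarrow> f x \<in> S" "S \<noteq> {0}"
  obtains e where "e \<in> S" "norm e = 1" "f e = (e \<bullet> f e) *\<^sub>R e"
    "\<And>x. x \<in> S \<Longrightarrow> x \<bullet> f x \<le> (e \<bullet> f e) * (norm x)\<^sup>2"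
proof -
  let ?K = "S \<inter> sphere 0 1"
  have "compact ?K"
    by (intro closed_Int_compact closed_subspace S compact_sphere)
  moreover obtain x where "x \<in> S" "x \<noteq> 0" using S subspace_0 by blast
  hence "x /\<^sub>R norm x \<in> ?K" using S by (simp add: subspace_scale)
  hence "?K \<noteq> {}" by blast
  moreover have "continuous_on ?K (\<lambda>x. x \<bullet> f x)"
    by (intro continuous_intros linear_continuous_on linear_conv_bounded_linear[THEN iffD1] f)
  ultimately obtain e where "e \<in> ?K" and K: "\<forall>x\<in>?K. x \<bullet> f x \<le> e \<bullet> f e"
    using continuous_attains_sup[of ?K "\<lambda>x. x \<bullet> f x"] by metis
  hence e: "e \<in> S" "norm e = 1" by auto
  have max: "x \<bullet> f x \<le> e \<bullet> f e" if "x \<in> S" "norm x = 1" for x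
    using K that by simp
  define c where "c = e \<bullet> f e"
  have le: "x \<bullet> f x \<le> c * (norm x)\<^sup>2" if "x \<in> S" for x
  proof (cases "x = 0")
    case False
    hence "(x /\<^sub>R norm x) \<bullet> f (x /\<^sub>R norm x) \<le> c"
      unfolding c_def using S that by (intro max) (auto simp: subspace_scale)
    thus ?thesis using False
      by (simp add: linear_scale[OF f] divide_simps power2_eq_square mult_ac)
  qed (simp add: linear_0[OF f])
  define w where "w = f e - c *\<^sub>R e"
  have w: "w \<in> S" unfolding w_def using S e by (simp add: subspace_diff subspace_scale)
  have "2 * t * (w \<bullet> w) \<le> t\<^sup>2 * (c * (norm w)\<^sup>2 - w \<bullet> f w)" for t :: real
  proof -
    have le': "(e + t *\<^sub>R w) \<bullet> f (e + t *\<^sub>R w) \<le> c * (norm (e + t *\<^sub>R w))\<^sup>2"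
      using S e w by (intro le subspace_add subspace_scale)
    have f': "(e + t *\<^sub>R w) \<bullet> f (e + t *\<^sub>R w) = c + 2 * t * (w \<bullet> f e) + t\<^sup>2 * (w \<bullet> f w)"
      using sym[of e w] unfolding c_def
      by (simp add: linear_add[OF f] linear_scale[OF f] inner_simps power2_eq_square inner_commute algebra_simps)
    have n': "(norm (e + t *\<^sub>R w))\<^sup>2 = 1 + 2 * t * (w \<bullet> e) + t\<^sup>2 * (norm w)\<^sup>2"
      using e unfolding power2_norm_eq_inner
      by (simp add: inner_simps norm_eq_1 power2_eq_square inner_commute algebra_simps)
    have ww: "w \<bullet> f e = w \<bullet> w + c * (w \<bullet> e)"
      by (subst (3) w_def) (simp add: inner_simps)
    show ?thesis using le'[unfolded f' n', unfolded ww] by (simp add: algebra_simps)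
  qed
  note quad = this
  have "w \<bullet> w \<le> 0"
  proof (rule ccontr)
    assume "\<not> w \<bullet> w \<le> 0"
    hence p: "w \<bullet> w > 0" by linarith
    \<comment> \<open>For \<open>w \<noteq> 0\<close> the quadratic bound fails at small positive
      \<open>t\<close>; this choice turns it into
      \<open>2 * (w \<bullet> w) \<le> w \<bullet> w\<close>.\<close>
    define M where "M = \<bar>c * (norm w)\<^sup>2 - w \<bullet> f w\<bar> + 1"
    define t where "t = (w \<bullet> w) / M"
    have M: "M > 0" by (simp add: M_def)
    hence t: "t > 0" using p by (simp add: t_def)
    have "2 * t * (w \<bullet> w) \<le> t\<^sup>2 * M"
      using quad[of t] by (rule order_trans) (auto simp: M_def intro!: mult_left_mono)
    hence "2 * (w \<bullet> w) \<le> t * M" using t by (simp add: power2_eq_square)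
    thus False using p M by (simp add: t_def)
  qed
  hence "w = 0" using inner_ge_zero[of w] by (metis antisym inner_eq_zero_iff)
  hence "f e = (e \<bullet> f e) *\<^sub>R e" by (simp add: w_def c_def)
  thus ?thesis using that e le c_def by blast
qed

definition orthonormal_basis :: "'a::euclidean_space set \<Rightarrow> bool" where
  "orthonormal_basis B \<longleftrightarrow>
     finite B \<and> pairwise orthogonal B \<and> (\<forall>b\<in>B. norm b = 1) \<and> span B = UNIV"

lemma orthonormal_basis_sum: "orthonormal_basis B \<Longrightarrow> (\<Sum>b\<in>B. (x \<bullet> b) *\<^sub>R b) = x"
  by (rule orthonormal_basis_expand) (auto simp: orthonormal_basis_def)

lemma orthonormal_basis_inner:
  "orthonormal_basis B \<Longrightarrow> a \<in> B \<Longrightarrow> b \<in> B \<Longrightarrow> a \<bullet> b = (if a = b then 1 else 0)"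
  by (auto simp: orthonormal_basis_def pairwise_def orthogonal_def norm_eq_1)

lemma orthonormal_basis_parseval:
  assumes "orthonormal_basis B"
  shows "x \<bullet> y = (\<Sum>b\<in>B. (x \<bullet> b) * (y \<bullet> b))"
proof -
  have "x \<bullet> y = (\<Sum>b\<in>B. (x \<bullet> b) *\<^sub>R b) \<bullet> y" using assms by (simp add: orthonormal_basis_sum)
  thus ?thesis by (simp add: inner_sum_left inner_commute[of y])
qed

lemma orthonormal_basis_independent: "orthonormal_basis B \<Longrightarrow> C \<subseteq> B \<Longrightarrow> independent C"
  unfolding orthonormal_basis_def
  by (metis independent_mono norm_zero pairwise_orthogonal_independent zero_neq_one)

text \<open>An orthonormal set of eigenvectors of largest cardinality works: by symmetry its
  orthogonal complement is invariant under \<open>f\<close>, so if it were nonzero it would contain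
  a further eigenvector.\<close>

lemma selfadjoint_orthonormal_eigenbasis:
  fixes f :: "'a::euclidean_space \<Rightarrow> 'a"
  assumes f: "linear f" and sym: "\<And>x y. f x \<bullet> y = x \<bullet> f y"
  obtains B where "orthonormal_basis B" "\<And>b. b \<in> B \<Longrightarrow> f b = (b \<bullet> f b) *\<^sub>R b"
proof -
  define P where "P B \<longleftrightarrow> pairwise orthogonal B \<and> (\<forall>b\<in>B. norm b = 1 \<and> f b = (b \<bullet> f b) *\<^sub>R b)" for B
  have ind: "independent B" if "P B" for B
    using that pairwise_orthogonal_independent[of B] by (force simp: P_def)
  hence bd: "card B \<le> DIM('a)" "finite B" if "P B" for B
    using independent_bound[OF ind[OF that]] by auto
  have "P {}" by (simp add: P_def pairwise_def)
  then obtain B where B: "P B" and "\<forall>C. P C \<longrightarrow> card C \<le> card B"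
    using ex_has_greatest_nat[of P "{}" card "Suc DIM('a)"] bd(1) le_imp_less_Suc by blast
  hence max: "\<And>C. P C \<Longrightarrow> card C \<le> card B" by simp
  define S where "S = {x. \<forall>b\<in>B. x \<bullet> b = 0}"
  have "subspace S" unfolding S_def by (auto simp: subspace_def inner_simps)
  moreover have "f x \<in> S" if "x \<in> S" for x
    unfolding S_def
  proof safe
    fix b assume b: "b \<in> B"
    have "f x \<bullet> b = x \<bullet> f b" by (rule sym)
    also have "\<dots> = x \<bullet> ((b \<bullet> f b) *\<^sub>R b)" using B b by (auto simp: P_def)
    also have "\<dots> = 0" using that b by (simp add: S_def)
    finally show "f x \<bullet> b = 0" .
  qed
  ultimately have "S = {0}"
  proof (rule_tac ccontr)
    assume S: "subspace S" "\<And>x. x \<in> S \<Longrightarrow> f x \<in> S" "S \<noteq> {0}"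
    obtain e where e: "e \<in> S" "norm e = 1" "f e = (e \<bullet> f e) *\<^sub>R e"
      using selfadjoint_eigenvector[OF f sym S] by blast
    have "P (insert e B)"
      using B e by (auto simp: P_def S_def pairwise_insert orthogonal_def inner_commute)
    moreover have "e \<notin> B" using e by (auto simp: S_def norm_eq_1)
    ultimately show False using max[of "insert e B"] bd(2)[OF B] by simp
  qed
  hence "span B = UNIV"
  proof (rule_tac ccontr)
    assume S: "S = {0}" and "span B \<noteq> UNIV"
    then obtain x where "x \<noteq> 0" "\<And>y. y \<in> span B \<Longrightarrow> orthogonal x y"
      using orthogonal_to_subspace_exists_gen[of B UNIV] by (metis psubsetI span_UNIV subset_UNIV)
    hence "x \<in> S" by (auto simp: S_def orthogonal_def span_base)
    thus False using S \<open>x \<noteq> 0\<close> by simp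
  qed
  thus ?thesis using B bd(2)[OF B] by (intro that[of B]) (auto simp: orthonormal_basis_def P_def)
qed

section \<open>Singular values and trace norm through the Gram operator\<close>

abbreviation gram :: "real^'m^'d \<Rightarrow> real^'m \<Rightarrow> real^'m" where
  "gram A x \<equiv> transpose A *v (A *v x)"

text \<open>Here the transpose is rewritten as a row vector product. Elsewhere that simp rule is
  switched off, so that the two factors of \<open>gram\<close> stay visible.\<close>

lemma inner_transpose: "(transpose A *v y) \<bullet> x = y \<bullet> (A *v x)" for A :: "real^'m^'d"
  by (simp add: transpose_matrix_vector dot_lmul_matrix)

lemma inner_gram: "gram A x \<bullet> y = (A *v x) \<bullet> (A *v y)"
  by (rule inner_transpose)

lemma gram_sym: "gram A x \<bullet> y = x \<bullet> gram A y"
  by (metis inner_gram inner_commute)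

lemma inner_gram_self: "x \<bullet> gram A x = (norm (A *v x))\<^sup>2"
  by (metis inner_gram inner_commute power2_norm_eq_inner)

lemma linear_gram: "linear (gram A)"
  by (auto intro!: linearI simp: matrix_vector_right_distrib matrix_vector_mult_scaleR)

lemma gram_eigenbasis:
  fixes A :: "real^'m^'d"
  obtains B where "orthonormal_basis B" "\<And>b. b \<in> B \<Longrightarrow> gram A b = (norm (A *v b))\<^sup>2 *\<^sub>R b"
  using selfadjoint_orthonormal_eigenbasis[OF linear_gram gram_sym, of A] inner_gram_self[of _ A] by metis

text \<open>Links the multiplicity in the definition to the lengths \<open>norm (A *v b)\<close>.
  Eigenvectors for different eigenvalues are orthogonal, so only basis vectors of length exactly
  \<open>s\<close> survive in the expansion of an eigenvector for \<open>s\<^sup>2\<close>.\<close>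

lemma dim_gram_eigenspace:
  fixes A :: "real^'m^'d"
  assumes B: "orthonormal_basis B" and eig: "\<And>b. b \<in> B \<Longrightarrow> gram A b = (norm (A *v b))\<^sup>2 *\<^sub>R b"
    and s: "s > 0"
  shows "sv_mult A s = card {b \<in> B. norm (A *v b) = s}"
proof -
  let ?C = "{b \<in> B. norm (A *v b) = s}" and ?E = "{x. gram A x = s\<^sup>2 *\<^sub>R x}"
  have "dim ?E = card ?C"
  proof (rule dim_unique)
    show "?C \<subseteq> ?E" using eig by auto
    show "independent ?C" using orthonormal_basis_independent[OF B, of ?C] by auto
    show "?E \<subseteq> span ?C"
    proof
      fix x assume x: "x \<in> ?E"
      have "x \<bullet> b = 0" if "b \<in> B" "b \<notin> ?C" for b
      proof -
        have "s\<^sup>2 * (x \<bullet> b) = gram A x \<bullet> b" using x by simp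
        also have "\<dots> = (norm (A *v b))\<^sup>2 * (x \<bullet> b)" using eig[OF that(1)] by (simp add: gram_sym)
        finally have "s\<^sup>2 = (norm (A *v b))\<^sup>2 \<or> x \<bullet> b = 0" by auto
        thus ?thesis using that s by (auto simp: power2_eq_iff_nonneg)
      qed
      hence "(\<Sum>b\<in>?C. (x \<bullet> b) *\<^sub>R b) = (\<Sum>b\<in>B. (x \<bullet> b) *\<^sub>R b)"
        using B by (intro sum.mono_neutral_left) (auto simp: orthonormal_basis_def)
      hence "x = (\<Sum>b\<in>?C. (x \<bullet> b) *\<^sub>R b)" using orthonormal_basis_sum[OF B, of x] by simp
      thus "x \<in> span ?C" by (metis (no_types, lifting) span_sum span_scale span_base)
    qed
  qed simp
  thus ?thesis using s by (simp add: sv_mult_def matrix_vector_mul_assoc)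
qed

lemma trace_norm_eq_sum:
  fixes A :: "real^'m^'d"
  assumes B: "orthonormal_basis B" and eig: "\<And>b. b \<in> B \<Longrightarrow> gram A b = (norm (A *v b))\<^sup>2 *\<^sub>R b"
  shows "trace_norm A = (\<Sum>b\<in>B. norm (A *v b))"
proof -
  let ?n = "\<lambda>b. norm (A *v b)"
  have fB: "finite B" using B by (simp add: orthonormal_basis_def)
  let ?T = "{s. sv_mult A s > 0} \<union> ?n ` B"
  have fT: "finite ?T" using fB finite_sv_mult[of A] by simp
  have sum_mset: "sum_mset (\<Sum>s\<in>P. replicate_mset (c s) s) = (\<Sum>s\<in>P. real (c s) * s)"
    if "finite P" for P and c :: "real \<Rightarrow> nat"
    using that by induction (auto simp: sum_mset_replicate_mset)
  \<comment> \<open>At \<open>s = 0\<close> the two counts may differ, one being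
    \<open>min d m - rank A\<close> and the other the number of basis vectors in the kernel; the
    factor \<open>s\<close> removes both. For negative \<open>s\<close> both counts are
    zero.\<close>
  have mult: "real (sv_mult A s) * s = real (card {b \<in> B. ?n b = s}) * s" for s
  proof (cases "s > 0")
    case False
    have "card {b \<in> B. ?n b = s} = 0" if "s \<noteq> 0"
    proof -
      have "s < 0" using False that by simp
      hence "{b \<in> B. ?n b = s} = {}" using norm_ge_zero by (smt (verit) Collect_empty_eq)
      thus ?thesis by (simp only: card.empty)
    qed
    thus ?thesis using False by (auto simp: sv_mult_def)
  qed (simp add: dim_gram_eigenspace[OF B eig])
  have "trace_norm A = (\<Sum>s | sv_mult A s > 0. real (sv_mult A s) * s)"
    unfolding trace_norm_def singular_values_def by (rule sum_mset[OF finite_sv_mult])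
  also have "\<dots> = (\<Sum>s\<in>?T. real (sv_mult A s) * s)"
    by (rule sum.mono_neutral_left) (use fT in auto)
  also have "\<dots> = (\<Sum>s\<in>?T. real (card {b \<in> B. ?n b = s}) * s)" by (simp add: mult)
  also have "\<dots> = (\<Sum>s\<in>?T. \<Sum>b | b \<in> B \<and> ?n b = s. ?n b)"
    by (intro sum.cong) auto
  also have "\<dots> = (\<Sum>b\<in>B. ?n b)"
    by (rule sum.group) (use fB fT in auto)
  finally show ?thesis .
qed

section \<open>Duality of the trace norm and the operator norm\<close>

lemma inner_matrix_basis:
  fixes A C :: "real^'m^'d"
  assumes "orthonormal_basis B"
  shows "A \<bullet> C = (\<Sum>b\<in>B. (A *v b) \<bullet> (C *v b))"
proof -
  have "A \<bullet> C = (\<Sum>i\<in>UNIV. \<Sum>b\<in>B. (A $ i \<bullet> b) * (C $ i \<bullet> b))"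
    unfolding inner_vec_def[of A C] by (intro sum.cong refl orthonormal_basis_parseval assms)
  also have "\<dots> = (\<Sum>b\<in>B. \<Sum>i\<in>UNIV. (A $ i \<bullet> b) * (C $ i \<bullet> b))" by (rule sum.swap)
  finally show ?thesis
    by (simp add: inner_vec_def[of "A *v _"] matrix_vector_mul_component)
qed

text \<open>Hoelder's inequality: in an eigenbasis of \<open>gram A\<close> the trace norm is the
  sum of the lengths of the images \<open>A *v b\<close>, and Cauchy-Schwarz applies to each summand
  of the inner product.\<close>

lemma abs_inner_le_trace_norm:
  fixes A C :: "real^'m^'d"
  assumes C: "\<And>x. norm (C *v x) \<le> \<sigma> * norm x"
  shows "\<bar>A \<bullet> C\<bar> \<le> \<sigma> * trace_norm A"
proof -
  obtain B where B: "orthonormal_basis B"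
    and eig: "\<And>b. b \<in> B \<Longrightarrow> gram A b = (norm (A *v b))\<^sup>2 *\<^sub>R b"
    using gram_eigenbasis[of A] by blast
  have "\<bar>(A *v b) \<bullet> (C *v b)\<bar> \<le> \<sigma> * norm (A *v b)" if "b \<in> B" for b
  proof -
    have "\<bar>(A *v b) \<bullet> (C *v b)\<bar> \<le> norm (A *v b) * norm (C *v b)" by (rule Cauchy_Schwarz_ineq2)
    also have "\<dots> \<le> norm (A *v b) * \<sigma>"
      using C[of b] B that by (intro mult_left_mono) (auto simp: orthonormal_basis_def)
    finally show ?thesis by (simp add: mult.commute)
  qed
  hence "\<bar>A \<bullet> C\<bar> \<le> (\<Sum>b\<in>B. \<sigma> * norm (A *v b))"
    unfolding inner_matrix_basis[OF B] by (rule order_trans[OF sum_abs sum_mono])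
  moreover have "trace_norm A = (\<Sum>b\<in>B. norm (A *v b))"
    using B eig by (rule trace_norm_eq_sum)
  ultimately show ?thesis by (simp add: sum_distrib_left)
qed

lemma inner_sgn: "x \<bullet> sgn x = norm x"
  by (cases "x = 0") (auto simp: sgn_div_norm power2_norm_eq_inner[symmetric] power2_eq_square)

text \<open>The witness is the partial isometry of the polar decomposition, sending \<open>b\<close>
  to \<open>sgn (A *v b)\<close>; as \<open>sgn 0 = 0\<close>, kernel vectors go to 0. The images
  \<open>A *v b\<close> are pairwise orthogonal because the \<open>b\<close> are eigenvectors of
  \<open>gram A\<close>, so Pythagoras makes it a contraction. With
  \<open>abs_inner_le_trace_norm\<close> the trace norm becomes a maximum of linear functionals,
  which yields convexity and the triangle inequality.\<close>

lemma trace_norm_attained: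
  fixes A :: "real^'m^'d"
  obtains C :: "real^'m^'d" where "\<And>x. norm (C *v x) \<le> norm x" "A \<bullet> C = trace_norm A"
proof -
  obtain B where B: "orthonormal_basis B"
    and eig: "\<And>b. b \<in> B \<Longrightarrow> gram A b = (norm (A *v b))\<^sup>2 *\<^sub>R b"
    using gram_eigenbasis[of A] by blast
  have tn: "trace_norm A = (\<Sum>b\<in>B. norm (A *v b))"
    using B eig by (rule trace_norm_eq_sum)
  have fB: "finite B" using B by (simp add: orthonormal_basis_def)
  define g where "g x = (\<Sum>b\<in>B. (x \<bullet> b) *\<^sub>R sgn (A *v b))" for x
  have "linear g"
    unfolding g_def
    by (intro linearI) (simp_all add: inner_simps scaleR_left_distrib sum.distrib scaleR_sum_right)
  hence mat: "matrix g *v x = g x" for x by (simp add: matrix_works linear_matrix_vector_mul_eq)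
  have orth: "sgn (A *v a) \<bullet> sgn (A *v b) = 0" if "a \<in> B" "b \<in> B" "a \<noteq> b" for a b
  proof -
    have "(A *v a) \<bullet> (A *v b) = gram A a \<bullet> b" by (simp add: inner_gram)
    thus ?thesis using that orthonormal_basis_inner[OF B that(1,2)] eig[of a] by (simp add: sgn_div_norm)
  qed
  have "(norm (g x))\<^sup>2 \<le> (norm x)\<^sup>2" for x
  proof -
    have "(norm (g x))\<^sup>2 = (\<Sum>b\<in>B. (norm ((x \<bullet> b) *\<^sub>R sgn (A *v b)))\<^sup>2)"
      unfolding g_def using orth
      by (intro norm_sum_Pythagorean fB) (auto simp: pairwise_def orthogonal_def)
    also have "\<dots> \<le> (\<Sum>b\<in>B. (x \<bullet> b) * (x \<bullet> b))"
      by (intro sum_mono) (auto simp: norm_sgn power2_eq_square)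
    also have "\<dots> = (norm x)\<^sup>2"
      by (simp add: orthonormal_basis_parseval[OF B, of x x] power2_norm_eq_inner)
    finally show ?thesis .
  qed
  hence "norm (g x) \<le> norm x" for x by (rule power2_le_imp_le) simp
  moreover have "g b = sgn (A *v b)" if "b \<in> B" for b
  proof -
    have "g b = (\<Sum>c\<in>B. if b = c then sgn (A *v c) else 0)"
      unfolding g_def by (intro sum.cong) (auto simp: orthonormal_basis_inner[OF B that])
    thus ?thesis using that fB by simp
  qed
  hence "A \<bullet> matrix g = trace_norm A"
    unfolding inner_matrix_basis[OF B] tn mat
    by (intro sum.cong) (simp_all add: inner_sgn)
  ultimately show ?thesis using that[of "matrix g"] mat by simp
qed

lemma convex_trace_ball: "convex (trace_ball \<mu> :: (real^'m^'d) set)"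
proof (rule convexI)
  fix A B :: "real^'m^'d" and u v :: real
  assume AB: "A \<in> trace_ball \<mu>" "B \<in> trace_ball \<mu>" and uv: "0 \<le> u" "0 \<le> v" "u + v = 1"
  obtain C where C: "\<And>x. norm (C *v x) \<le> norm x"
      "(u *\<^sub>R A + v *\<^sub>R B) \<bullet> C = trace_norm (u *\<^sub>R A + v *\<^sub>R B)"
    using trace_norm_attained by blast
  have "trace_norm (u *\<^sub>R A + v *\<^sub>R B) = u * (A \<bullet> C) + v * (B \<bullet> C)"
    by (simp add: C(2)[symmetric] inner_simps)
  also have "\<dots> \<le> u * \<mu> + v * \<mu>"
    using abs_inner_le_trace_norm[of C 1 A] abs_inner_le_trace_norm[of C 1 B] C(1) AB uv
    by (intro add_mono mult_left_mono) (auto simp: trace_ball_def)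
  finally show "u *\<^sub>R A + v *\<^sub>R B \<in> trace_ball \<mu>"
    using uv by (simp add: trace_ball_def distrib_right[symmetric])
qed

lemma trace_norm_diff_le: "trace_norm (A - B) \<le> trace_norm A + trace_norm B"
  for A B :: "real^'m^'d"
proof -
  obtain C where C: "\<And>x. norm (C *v x) \<le> norm x" "(A - B) \<bullet> C = trace_norm (A - B)"
    using trace_norm_attained by blast
  have "trace_norm (A - B) = A \<bullet> C - B \<bullet> C" by (simp add: C(2)[symmetric] inner_simps)
  thus ?thesis
    using abs_inner_le_trace_norm[of C 1 A] abs_inner_le_trace_norm[of C 1 B] C(1) by force
qed

lemma inner_outer: "outer u v \<bullet> C = u \<bullet> (C *v v)"
proof -
  have "outer u v \<bullet> C = (\<Sum>i\<in>UNIV. \<Sum>j\<in>UNIV. u $ i * v $ j * C $ i $ j)"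
    by (simp add: inner_vec_def outer_def)
  also have "\<dots> = u \<bullet> (C *v v)"
    by (simp add: inner_vec_def matrix_vector_mult_def sum_distrib_left mult_ac)
  finally show ?thesis .
qed

lemma outer_mult_vector: "outer u v *v x = (v \<bullet> x) *\<^sub>R u"
  by (simp add: vec_eq_iff matrix_vector_mult_def outer_def inner_vec_def sum_distrib_left mult_ac)

lemma norm_outer: "norm (outer u v) = norm u * norm v"
  by (rule power2_eq_imp_eq)
    (auto simp: power2_norm_eq_inner inner_outer outer_mult_vector power_mult_distrib)

lemma trace_norm_outer_le: "trace_norm (outer u v) \<le> norm u * norm v"
proof -
  obtain C where C: "\<And>x. norm (C *v x) \<le> norm x" "outer u v \<bullet> C = trace_norm (outer u v)"
    using trace_norm_attained by blast
  have "trace_norm (outer u v) = u \<bullet> (C *v v)" by (simp add: C(2)[symmetric] inner_outer)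
  also have "\<dots> \<le> norm u * norm (C *v v)" by (rule norm_cauchy_schwarz)
  also have "\<dots> \<le> norm u * norm v" by (intro mult_left_mono C) simp
  finally show ?thesis .
qed

lemma scaleR_outer_in_trace_ball:
  assumes "norm u = 1" "norm v = 1" "0 \<le> \<mu>"
  shows "- (\<mu> *\<^sub>R outer u v) \<in> trace_ball \<mu>"
proof -
  have "- (\<mu> *\<^sub>R outer u v) = outer ((- \<mu>) *\<^sub>R u) v" by (simp add: outer_def vec_eq_iff)
  thus ?thesis using trace_norm_outer_le[of "(- \<mu>) *\<^sub>R u" v] assms by (simp add: trace_ball_def)
qed

section \<open>Operator norm and top singular vector\<close>

lemma norm_matrix_vector_le_onorm: "norm (A *v x) \<le> onorm ((*v) A) * norm x"
  for A :: "real^'m^'d"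
  by (rule onorm) simp

text \<open>The operator norm is 1-Lipschitz for the Frobenius norm, as seen by pairing
  \<open>A - B\<close> with a rank-one matrix. Continuity is wanted for the measurability of the
  power iteration error.\<close>

lemma continuous_on_onorm: "continuous_on S (\<lambda>A :: real^'m^'d. onorm ((*v) A))"
proof (rule continuous_on_subset)
  have le: "onorm ((*v) A) \<le> onorm ((*v) B) + norm (A - B)" for A B :: "real^'m^'d"
  proof (rule onorm_le)
    fix x
    let ?y = "(A - B) *v x"
    have "(norm ?y)\<^sup>2 = outer ?y x \<bullet> (A - B)" by (simp add: inner_outer power2_norm_eq_inner)
    also have "\<dots> \<le> norm (outer ?y x) * norm (A - B)" by (rule norm_cauchy_schwarz)
    also have "norm (outer ?y x) = norm ?y * norm x" by (rule norm_outer)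
    finally have "norm ?y * norm ?y \<le> norm ?y * (norm x * norm (A - B))"
      by (simp add: power2_eq_square mult_ac)
    hence "norm ?y \<le> norm (A - B) * norm x"
      by (cases "norm ?y = 0") (auto simp: mult_ac)
    moreover have "A *v x = B *v x + ?y" by (simp add: matrix_vector_mult_diff_rdistrib)
    ultimately show "norm (A *v x) \<le> (onorm ((*v) B) + norm (A - B)) * norm x"
      using norm_matrix_vector_le_onorm[of B x] norm_triangle_ineq[of "B *v x" ?y]
      by (simp add: distrib_right)
  qed
  have "1-lipschitz_on UNIV (\<lambda>A :: real^'m^'d. onorm ((*v) A))"
  proof (rule lipschitz_onI)
    fix A B :: "real^'m^'d"
    show "dist (onorm ((*v) A)) (onorm ((*v) B)) \<le> 1 * dist A B"
      using le[of A B] le[of B A] by (simp add: dist_norm abs_le_iff norm_minus_commute)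
  qed simp
  thus "continuous_on UNIV (\<lambda>A :: real^'m^'d. onorm ((*v) A))"
    by (rule lipschitz_on_continuous_on)
qed simp

lemma top_singular_vector:
  fixes A :: "real^'m^'d"
  obtains e where "norm e = 1" "norm (A *v e) = onorm ((*v) A)" "gram A e = (onorm ((*v) A))\<^sup>2 *\<^sub>R e"
proof -
  have "axis undefined 1 \<noteq> (0 :: real^'m)" by (simp add: axis_eq_0_iff)
  hence "(UNIV :: (real^'m) set) \<noteq> {0}" by blast
  then obtain e where e1: "norm e = 1" and eig: "gram A e = (e \<bullet> gram A e) *\<^sub>R e"
    and "\<And>x. x \<in> UNIV \<Longrightarrow> x \<bullet> gram A x \<le> (e \<bullet> gram A e) * (norm x)\<^sup>2"
    using selfadjoint_eigenvector[OF linear_gram gram_sym subspace_UNIV UNIV_I, of A] by blast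
  hence max: "x \<bullet> gram A x \<le> (e \<bullet> gram A e) * (norm x)\<^sup>2" for x by blast
  note e = e1 eig[unfolded inner_gram_self]
  have n: "norm (A *v e) = onorm ((*v) A)"
  proof (rule antisym)
    show "norm (A *v e) \<le> onorm ((*v) A)"
      using norm_matrix_vector_le_onorm[of A e] e1 by simp
    show "onorm ((*v) A) \<le> norm (A *v e)"
    proof (rule onorm_le)
      fix x
      show "norm (A *v x) \<le> norm (A *v e) * norm x"
        using max[of x] by (rule_tac power2_le_imp_le) (auto simp: inner_gram_self power_mult_distrib)
    qed
  qed
  show ?thesis by (rule that[OF e1 n]) (rule e(2)[unfolded n])
qed

section \<open>Ordered singular values and the spectral gap\<close>

lemma singular_value_if_gram_eigenvector:
  fixes A :: "real^'m^'d"
  assumes "s > 0" "x \<noteq> 0" "gram A x = s\<^sup>2 *\<^sub>R x"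
  shows "s \<in># singular_values A"
proof -
  have "dim {x. gram A x = s\<^sup>2 *\<^sub>R x} > 0"
    unfolding neq0_conv[symmetric] using assms by auto
  hence "count (singular_values A) s > 0"
    using assms by (simp add: count_singular_values sv_mult_def matrix_vector_mul_assoc del: dim_eq_0)
  thus ?thesis by simp
qed

lemma singular_value_bounds:
  fixes A :: "real^'m^'d"
  assumes "s \<in># singular_values A"
  shows "0 \<le> s" "s \<le> onorm ((*v) A)"
proof -
  have pos: "sv_mult A s > 0" using assms by (metis count_singular_values count_greater_zero_iff)
  thus "0 \<le> s" by (auto simp: sv_mult_def split: if_splits)
  show "s \<le> onorm ((*v) A)"
  proof (cases "s = 0")
    case False
    hence s: "s > 0" using \<open>0 \<le> s\<close> by simp
    with pos have "dim {x. gram A x = s\<^sup>2 *\<^sub>R x} > 0"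
      by (simp add: sv_mult_def matrix_vector_mul_assoc)
    hence "dim {x. gram A x = s\<^sup>2 *\<^sub>R x} \<noteq> 0" by (rule gr_implies_not0)
    then obtain x where x: "x \<noteq> 0" "gram A x = s\<^sup>2 *\<^sub>R x" by (auto simp: dim_eq_0)
    have "(norm (A *v x))\<^sup>2 = (s * norm x)\<^sup>2"
      using x inner_gram_self[of x A] by (simp add: power_mult_distrib power2_norm_eq_inner)
    hence "norm (A *v x) = s * norm x" using s by (simp add: power2_eq_iff_nonneg)
    thus ?thesis using norm_matrix_vector_le_onorm[of A x] x by simp
  qed (simp add: onorm_pos_le)
qed

lemma sing_val_nonneg:
  fixes A :: "real^'m^'d"
  assumes "k \<ge> 1"
  shows "0 \<le> sing_val A k"
proof -
  define xs where "xs = rev (sorted_list_of_multiset (singular_values A))"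
  show ?thesis
  proof (cases "k \<le> length xs")
    case True
    hence "xs ! (k - 1) \<in> set xs" using assms by (intro nth_mem) auto
    hence "xs ! (k - 1) \<in># singular_values A" by (simp add: xs_def)
    thus ?thesis using True singular_value_bounds(1) by (simp add: sing_val_def Let_def xs_def)
  qed (simp add: sing_val_def Let_def xs_def)
qed

lemma sing_val_1_eq:
  fixes A :: "real^'m^'d"
  assumes "s \<in># singular_values A" "\<And>r. r \<in># singular_values A \<Longrightarrow> r \<le> s"
  shows "sing_val A 1 = s"
proof -
  define xs where "xs = rev (sorted_list_of_multiset (singular_values A))"
  have xs: "set xs = set_mset (singular_values A)" "sorted (rev xs)" by (simp_all add: xs_def)
  then obtain i where i: "i < length xs" "xs ! i = s"
    using assms(1) by (metis in_set_conv_nth)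
  hence "s \<le> xs ! 0" using sorted_rev_nth_mono[OF xs(2), of 0 i] by simp
  moreover have "xs ! 0 \<in> set xs" using i by (intro nth_mem) auto
  hence "xs ! 0 \<le> s" using assms(2) xs(1) by simp
  ultimately show ?thesis using i by (auto simp: sing_val_def Let_def xs_def[symmetric])
qed

lemma le_sing_val_2:
  fixes A :: "real^'m^'d"
  assumes "s \<in># singular_values A" "s \<noteq> sing_val A 1"
  shows "s \<le> sing_val A 2"
proof -
  define xs where "xs = rev (sorted_list_of_multiset (singular_values A))"
  have xs: "set xs = set_mset (singular_values A)" "sorted (rev xs)" by (simp_all add: xs_def)
  then obtain i where i: "i < length xs" "xs ! i = s"
    using assms(1) by (metis in_set_conv_nth)
  have "i \<noteq> 0"
  proof
    assume "i = 0"
    thus False using i assms(2) by (simp add: sing_val_def Let_def xs_def[symmetric] Suc_le_eq)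
  qed
  hence "s \<le> xs ! 1" "2 \<le> length xs"
    using sorted_rev_nth_mono[OF xs(2), of 1 i] i by auto
  thus ?thesis by (simp add: sing_val_def Let_def xs_def[symmetric])
qed

text \<open>The Rayleigh maximum of \<open>gram A\<close> on the complement of \<open>e\<close> is
  attained at some \<open>e'\<close>, with \<open>\<tau> = norm (A *v e')\<close>. If
  \<open>\<tau>\<close> were the top value, \<open>e\<close> and \<open>e'\<close> would be
  independent in an eigenspace that simplicity makes one-dimensional. So a positive
  \<open>\<tau>\<close> is a singular value other than the first, hence at most the second.\<close>

lemma spectral_gap:
  fixes A :: "real^'m^'d"
  assumes mult: "count (singular_values A) (sing_val A 1) = 1"
    and gap: "sing_val A 2 / sing_val A 1 < \<beta>"
    and pos: "onorm ((*v) A) > 0"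
    and e: "norm e = 1" "gram A e = (onorm ((*v) A))\<^sup>2 *\<^sub>R e"
    and x: "x \<bullet> e = 0"
  shows "norm (A *v x) \<le> \<beta> * onorm ((*v) A) * norm x"
proof -
  define \<sigma> where "\<sigma> = onorm ((*v) A)"
  have \<sigma>: "\<sigma> > 0" using pos by (simp add: \<sigma>_def)
  have "e \<noteq> 0" using e by auto
  hence s1: "sing_val A 1 = \<sigma>"
    using singular_value_if_gram_eigenvector[OF \<sigma>, of e] e singular_value_bounds(2)[of _ A]
    by (intro sing_val_1_eq) (auto simp: \<sigma>_def)
  have s2: "sing_val A 2 \<le> \<beta> * \<sigma>" using gap[unfolded s1] \<sigma> by (simp add: divide_less_eq)
  define S where "S = {x. x \<bullet> e = 0}"
  show ?thesis
  \<comment> \<open>With a single column the complement of \<open>e\<close> is trivial and offers no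
    unit vector to maximize over.\<close>
  proof (cases "S = {0}")
    case True
    hence "x = 0" using x by (auto simp: S_def)
    thus ?thesis by simp
  next
    case False
    have "subspace S" by (auto simp: S_def subspace_def inner_simps)
    moreover have "gram A y \<in> S" if "y \<in> S" for y
      using that e by (simp add: S_def gram_sym)
    ultimately obtain e' where e': "e' \<in> S" "norm e' = 1" "gram A e' = (e' \<bullet> gram A e') *\<^sub>R e'"
      and max: "\<And>y. y \<in> S \<Longrightarrow> y \<bullet> gram A y \<le> (e' \<bullet> gram A e') * (norm y)\<^sup>2"
      using selfadjoint_eigenvector[OF linear_gram gram_sym, of S A] False by blast
    define \<tau> where "\<tau> = norm (A *v e')"
    have "norm (A *v x) \<le> \<tau> * norm x"
      using max[of x] x unfolding \<tau>_def
      by (rule_tac power2_le_imp_le) (auto simp: inner_gram_self power_mult_distrib S_def)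
    moreover have "\<tau> \<le> sing_val A 2"
    \<comment> \<open>A zero \<open>\<tau>\<close> need not be listed among the singular values, for
      instance when there is only one row; nonnegativity of \<open>sing_val\<close> is then
      enough.\<close>
    proof (cases "\<tau> = 0")
      case False
      hence \<tau>: "\<tau> > 0" by (simp add: \<tau>_def)
      have eig': "gram A e' = \<tau>\<^sup>2 *\<^sub>R e'" using e'(3) by (simp only: inner_gram_self \<tau>_def)
      have e'0: "e' \<noteq> 0" using e'(2) by auto
      have "\<tau> \<noteq> \<sigma>"
      proof
        assume "\<tau> = \<sigma>"
        define E where "E = {x. gram A x = \<sigma>\<^sup>2 *\<^sub>R x}"
        have "e' \<noteq> e" using e'(1) e(1) by (auto simp: S_def norm_eq_1)
        have "independent {e, e'}"
          using e'(1) \<open>e \<noteq> 0\<close> e'0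
          by (intro pairwise_orthogonal_independent)
            (auto simp: pairwise_def orthogonal_def S_def inner_commute)
        moreover have "{e, e'} \<subseteq> E" using e eig' \<open>\<tau> = \<sigma>\<close> by (simp add: E_def \<sigma>_def)
        ultimately have "card {e, e'} \<le> dim E" by (rule independent_card_le_dim[rotated])
        moreover have "dim E = 1"
          using mult \<sigma> unfolding s1 count_singular_values
          by (simp add: sv_mult_def E_def matrix_vector_mul_assoc)
        ultimately show False using \<open>e' \<noteq> e\<close> by simp
      qed
      thus ?thesis
        using singular_value_if_gram_eigenvector[OF \<tau> e'0 eig'] le_sing_val_2[of \<tau> A, unfolded s1] by blast
    qed (simp add: sing_val_nonneg)
    hence "\<tau> * norm x \<le> (\<beta> * \<sigma>) * norm x" using s2 by (intro mult_right_mono) auto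
    ultimately show ?thesis by (simp add: \<sigma>_def)
  qed
qed

section \<open>Coordinates of a uniform point of the sphere\<close>

text \<open>For a unit vector \<open>e\<close>, the orthogonal projection onto the hyperplane
  perpendicular to \<open>e\<close>; it stands in for the remaining coordinates.\<close>

definition off_axis :: "'a::euclidean_space \<Rightarrow> 'a \<Rightarrow> 'a" where
  "off_axis e x = x - (x \<bullet> e) *\<^sub>R e"

lemma borel_measurable_off_axis [measurable]: "off_axis e \<in> borel_measurable borel"
  unfolding off_axis_def by simp

lemma off_axis_translate: "norm e = 1 \<Longrightarrow> off_axis e (y *\<^sub>R e + x) = off_axis e x"
  by (simp add: off_axis_def inner_left_distrib norm_eq_1 algebra_simps)

lemma off_axis_scaleR: "off_axis e (c *\<^sub>R x) = c *\<^sub>R off_axis e x"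
  by (simp add: off_axis_def algebra_simps)

lemma norm_off_axis_le: "norm e = 1 \<Longrightarrow> norm (off_axis e x) \<le> norm x"
proof -
  assume "norm e = 1"
  hence "(norm (off_axis e x))\<^sup>2 = (norm x)\<^sup>2 - (x \<bullet> e)\<^sup>2"
    unfolding power2_norm_eq_inner off_axis_def
    by (simp add: inner_simps norm_eq_1 power2_eq_square inner_commute)
  hence "(norm (off_axis e x))\<^sup>2 \<le> (norm x)\<^sup>2" by simp
  thus ?thesis by (rule power2_le_imp_le) simp
qed

lemma norm_le_off_axis: "norm e = 1 \<Longrightarrow> norm x \<le> norm (off_axis e x) + \<bar>x \<bullet> e\<bar>"
  using norm_triangle_ineq[of "off_axis e x" "(x \<bullet> e) *\<^sub>R e"] by (simp add: off_axis_def)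

section \<open>Slicing Lebesgue measure along a direction\<close>

lemma nn_integral_lborel_translate:
  fixes f :: "'a::euclidean_space \<Rightarrow> ennreal"
  assumes [measurable]: "f \<in> borel_measurable borel"
  shows "(\<integral>\<^sup>+x. f (c + x) \<partial>lborel) = (\<integral>\<^sup>+x. f x \<partial>lborel)"
  by (subst (2) lborel_distr_plus[of c, symmetric]) (simp add: nn_integral_distr)

lemma nn_integral_lborel_scale:
  fixes f :: "'a::euclidean_space \<Rightarrow> ennreal"
  assumes [measurable]: "f \<in> borel_measurable borel" and "c \<noteq> 0"
  shows "(\<integral>\<^sup>+x. f x \<partial>lborel) = ennreal (\<bar>c\<bar> ^ DIM('a)) * (\<integral>\<^sup>+x. f (c *\<^sub>R x) \<partial>lborel)"
  by (subst lborel_affine[OF \<open>c \<noteq> 0\<close>, of 0])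
     (simp add: nn_integral_density nn_integral_distr nn_integral_cmult)

lemma nn_integral_even:
  fixes f :: "real \<Rightarrow> ennreal"
  assumes [measurable]: "f \<in> borel_measurable borel" and even: "\<And>y. f (- y) = f y"
  shows "(\<integral>\<^sup>+y. f y \<partial>lborel) = 2 * (\<integral>\<^sup>+y. f y * indicator {0..} y \<partial>lborel)"
proof -
  have "(\<integral>\<^sup>+y. f y * indicator {..0} y \<partial>lborel) = (\<integral>\<^sup>+y. f (- y) * indicator {..0} (- y) \<partial>lborel)"
    by (subst nn_integral_real_affine[of _ "-1" 0]) auto
  also have "\<dots> = (\<integral>\<^sup>+y. f y * indicator {0..} y \<partial>lborel)"
    by (intro nn_integral_cong) (auto simp: even indicator_def)
  finally have neg: "(\<integral>\<^sup>+y. f y * indicator {..0} y \<partial>lborel) = (\<integral>\<^sup>+y. f y * indicator {0..} y \<partial>lborel)" .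
  have "(\<integral>\<^sup>+y. f y \<partial>lborel) = (\<integral>\<^sup>+y. f y * indicator {..0} y + f y * indicator {0..} y \<partial>lborel)"
    by (intro nn_integral_cong_AE eventually_mono[OF AE_lborel_singleton[of 0]])
       (auto simp: indicator_def)
  also have "\<dots> = (\<integral>\<^sup>+y. f y * indicator {..0} y \<partial>lborel) + (\<integral>\<^sup>+y. f y * indicator {0..} y \<partial>lborel)"
    by (intro nn_integral_add) auto
  finally show ?thesis by (simp add: neg mult_2)
qed

text \<open>Fubini in the direction \<open>e\<close> without a choice of coordinates: hyperplane sections are measured
  by thickening them to slabs of width \<open>1\<close>.\<close>

lemma nn_integral_slab:
  fixes e :: "'a::euclidean_space" and H :: "'a \<Rightarrow> real \<Rightarrow> ennreal"
  assumes e: "norm e = 1"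
    and [measurable]: "(\<lambda>(z, y). H z y) \<in> borel_measurable (borel \<Otimes>\<^sub>M borel)"
  shows "(\<integral>\<^sup>+x. H (off_axis e x) (x \<bullet> e) \<partial>lborel) =
    (\<integral>\<^sup>+y. \<integral>\<^sup>+x. H (off_axis e x) y * indicator {-(1/2)..1/2} (x \<bullet> e) \<partial>lborel \<partial>lborel)"
proof -
  let ?i = "indicator {-(1/2)..1/2} :: real \<Rightarrow> ennreal"
  have unit: "(\<integral>\<^sup>+y. ?i (a - y) \<partial>lborel) = 1" for a
  proof -
    have "(\<integral>\<^sup>+y. ?i (a - y) \<partial>lborel) = (\<integral>\<^sup>+y. indicator {a-1/2..a+1/2} y \<partial>lborel)"
      by (intro nn_integral_cong) (auto simp: indicator_def)
    thus ?thesis by simp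
  qed
  have ee: "e \<bullet> e = 1" using e by (simp add: norm_eq_1)
  \<comment> \<open>The factor 1 is inserted as the integral over \<open>y\<close> of the unit
    window at \<open>x \<bullet> e - y\<close>. After exchanging the integrals, translating
    \<open>x\<close> along \<open>e\<close> does not affect \<open>off_axis e x\<close>, and a
    translation of \<open>y\<close> then separates the height from the position inside the
    slab.\<close>
  have "(\<integral>\<^sup>+x. H (off_axis e x) (x \<bullet> e) \<partial>lborel) =
      (\<integral>\<^sup>+x. \<integral>\<^sup>+y. H (off_axis e x) (x \<bullet> e) * ?i (x \<bullet> e - y) \<partial>lborel \<partial>lborel)"
    by (subst nn_integral_cmult) (simp_all add: unit)
  also have "\<dots> = (\<integral>\<^sup>+y. \<integral>\<^sup>+x. H (off_axis e x) (x \<bullet> e) * ?i (x \<bullet> e - y) \<partial>lborel \<partial>lborel)"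
    by (rule lborel_pair.Fubini') measurable
  also have "\<dots> = (\<integral>\<^sup>+y. \<integral>\<^sup>+x. H (off_axis e x) (y + x \<bullet> e) * ?i (x \<bullet> e) \<partial>lborel \<partial>lborel)"
  proof (rule nn_integral_cong)
    fix y :: real
    have "(\<integral>\<^sup>+x. H (off_axis e x) (x \<bullet> e) * ?i (x \<bullet> e - y) \<partial>lborel)
        = (\<integral>\<^sup>+x. H (off_axis e (y *\<^sub>R e + x)) ((y *\<^sub>R e + x) \<bullet> e) * ?i ((y *\<^sub>R e + x) \<bullet> e - y) \<partial>lborel)"
      by (rule nn_integral_lborel_translate[symmetric]) measurable
    thus "(\<integral>\<^sup>+x. H (off_axis e x) (x \<bullet> e) * ?i (x \<bullet> e - y) \<partial>lborel)
        = (\<integral>\<^sup>+x. H (off_axis e x) (y + x \<bullet> e) * ?i (x \<bullet> e) \<partial>lborel)"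
      by (simp add: off_axis_translate e inner_left_distrib ee)
  qed
  also have "\<dots> = (\<integral>\<^sup>+x. \<integral>\<^sup>+y. H (off_axis e x) (y + x \<bullet> e) * ?i (x \<bullet> e) \<partial>lborel \<partial>lborel)"
    by (rule lborel_pair.Fubini') measurable
  also have "\<dots> = (\<integral>\<^sup>+x. \<integral>\<^sup>+y. H (off_axis e x) y * ?i (x \<bullet> e) \<partial>lborel \<partial>lborel)"
  proof (rule nn_integral_cong)
    fix x :: 'a
    have "(\<integral>\<^sup>+y. H (off_axis e x) (x \<bullet> e + y) * ?i (x \<bullet> e) \<partial>lborel)
        = (\<integral>\<^sup>+y. H (off_axis e x) y * ?i (x \<bullet> e) \<partial>lborel)"
      by (rule nn_integral_lborel_translate) measurable
    thus "(\<integral>\<^sup>+y. H (off_axis e x) (y + x \<bullet> e) * ?i (x \<bullet> e) \<partial>lborel)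
        = (\<integral>\<^sup>+y. H (off_axis e x) y * ?i (x \<bullet> e) \<partial>lborel)"
      by (simp add: add.commute)
  qed
  also have "\<dots> = (\<integral>\<^sup>+y. \<integral>\<^sup>+x. H (off_axis e x) y * ?i (x \<bullet> e) \<partial>lborel \<partial>lborel)"
    by (rule lborel_pair.Fubini') measurable
  finally show ?thesis .
qed

text \<open>For a unit vector \<open>e\<close>, the volume of a cylinder of radius \<open>r\<close>
  and height 1 about \<open>e\<close>, which is the volume of the ball of radius \<open>r\<close> in
  one dimension less.\<close>

definition slab :: "'a::euclidean_space \<Rightarrow> real \<Rightarrow> ennreal" where
  "slab e r = (\<integral>\<^sup>+x. indicator {..r} (norm (off_axis e x)) * indicator {-(1/2)..1/2} (x \<bullet> e) \<partial>lborel)"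

text \<open>Dilating the unit cylinder by \<open>r\<close> stretches its height as well, so the
  result is compared with the cylinder of radius \<open>r\<close> and height \<open>r\<close>.
  Cancelling that height lowers the exponent from the dimension to the dimension minus 1.\<close>

lemma slab_scale:
  fixes e :: "'a::euclidean_space"
  assumes e: "norm e = 1" and r: "r > 0"
  shows "slab e r = ennreal (r ^ (DIM('a) - 1)) * slab e 1"
proof -
  define H :: "'a \<Rightarrow> real \<Rightarrow> ennreal" where
    "H z y = indicator {..r} (norm z) * indicator {-r/2..r/2} y" for z y
  have [measurable]: "(\<lambda>(z, y). H z y) \<in> borel_measurable (borel \<Otimes>\<^sub>M borel)"
    unfolding H_def by measurable
  have "ennreal r * slab e r = (\<integral>\<^sup>+y. indicator {-r/2..r/2} y * slab e r \<partial>lborel)"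
    using r by (simp add: nn_integral_multc)
  also have "\<dots> = (\<integral>\<^sup>+y. \<integral>\<^sup>+x. H (off_axis e x) y * indicator {-(1/2)..1/2} (x \<bullet> e) \<partial>lborel \<partial>lborel)"
    unfolding slab_def H_def by (subst nn_integral_cmult[symmetric]) (auto simp: mult_ac)
  also have "\<dots> = (\<integral>\<^sup>+x. H (off_axis e x) (x \<bullet> e) \<partial>lborel)"
    by (rule nn_integral_slab[symmetric]) (use e in auto)
  also have "\<dots> = ennreal (r ^ DIM('a)) * (\<integral>\<^sup>+x. H (off_axis e (r *\<^sub>R x)) ((r *\<^sub>R x) \<bullet> e) \<partial>lborel)"
    using r by (subst nn_integral_lborel_scale[of _ r]) auto
  also have "(\<integral>\<^sup>+x. H (off_axis e (r *\<^sub>R x)) ((r *\<^sub>R x) \<bullet> e) \<partial>lborel) = slab e 1"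
  proof -
    have "(- r / 2 \<le> r * a) = (- (1/2) \<le> a)" "(r * a \<le> r / 2) = (a \<le> 1/2)" for a
      using r mult_le_cancel_left_pos[of r "-(1/2)" a] mult_le_cancel_left_pos[of r a "1/2"]
      by simp_all
    thus ?thesis unfolding slab_def H_def using r
      by (intro nn_integral_cong) (simp add: off_axis_scaleR indicator_def)
  qed
  also have "ennreal (r ^ DIM('a)) = ennreal r * ennreal (r ^ (DIM('a) - 1))"
    using r power_minus_mult[of "DIM('a)" r] by (simp add: ennreal_mult[symmetric] mult.commute)
  finally have "ennreal r * slab e r = ennreal r * (ennreal (r ^ (DIM('a) - 1)) * slab e 1)"
    by (simp add: mult_ac)
  thus ?thesis using r by (simp add: ennreal_mult_cancel_left)
qed

text \<open>\<open>H\<close> describes the double cone whose base is the equatorial disc and whose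
  apices are \<open>e\<close> and \<open>- e\<close>; its volume is \<open>2 / D\<close> times the
  base \<open>slab e 1\<close>. The same base appears in the upper bound by a cylinder, so it
  cancels from the density bound.\<close>

lemma emeasure_cball_ge_slab:
  fixes e :: "'a::euclidean_space"
  assumes e: "norm e = 1"
  shows "2 * slab e 1 \<le> ennreal (real DIM('a)) * emeasure lborel (cball (0::'a) 1)"
proof -
  define D where "D = DIM('a)"
  have D: "D > 0" by (simp add: D_def)
  define H :: "'a \<Rightarrow> real \<Rightarrow> ennreal" where
    "H z y = indicator {z. norm z \<le> 1 - \<bar>y\<bar>} z" for z y
  have H: "H z y = indicator {(z, y). norm z \<le> 1 - \<bar>y\<bar>} (z, y)" for z y
    by (simp add: H_def indicator_def)
  have [measurable]: "(\<lambda>(z, y). H z y) \<in> borel_measurable (borel \<Otimes>\<^sub>M borel)"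
    unfolding H by measurable
  have sl: "(\<integral>\<^sup>+x. H (off_axis e x) y * indicator {-(1/2)..1/2} (x \<bullet> e) \<partial>lborel) = slab e (1 - \<bar>y\<bar>)" for y
    unfolding slab_def H_def by (intro nn_integral_cong) (auto simp: indicator_def)
  have "((\<lambda>y. (1 - y) ^ (D - 1)) has_integral (- ((1 - 1) ^ D / D) - - ((1 - 0) ^ D / D))) {0..1::real}"
    using D by (intro fundamental_theorem_of_calculus)
       (auto intro!: derivative_eq_intros simp: has_real_derivative_iff_has_vector_derivative[symmetric])
  hence int: "(\<integral>\<^sup>+y. ennreal ((1 - y) ^ (D - 1)) * indicator {0..1} y \<partial>lborel) = ennreal (1 / D)"
    using D by (subst nn_integral_has_integral_lebesgue') (auto simp: zero_power)
  have "2 * slab e 1 = ennreal (real D) * (2 * (ennreal (1 / D) * slab e 1))"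
  proof -
    have "ennreal (real D) * ennreal (1 / D) = 1" using D by (simp add: ennreal_mult[symmetric])
    thus ?thesis by (metis mult.assoc mult.commute mult.left_neutral)
  qed
  also have "2 * (ennreal (1 / D) * slab e 1) = 2 * (\<integral>\<^sup>+y. ennreal ((1 - y) ^ (D - 1)) * indicator {0..1} y * slab e 1 \<partial>lborel)"
    by (subst nn_integral_multc) (simp_all add: int[simplified])
  also have "\<dots> \<le> 2 * (\<integral>\<^sup>+y. slab e (1 - \<bar>y\<bar>) * indicator {0..} y \<partial>lborel)"
  proof (intro mult_left_mono nn_integral_mono_AE)
    show "AE y in lborel. ennreal ((1 - y) ^ (D - 1)) * indicator {0..1} y * slab e 1
        \<le> slab e (1 - \<bar>y\<bar>) * indicator {0..} y"
      \<comment> \<open>At \<open>y = 1\<close> the radius is 0, which \<open>slab_scale\<close>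
        excludes; a single height is a null set.\<close>
      using AE_lborel_singleton[of 1]
    proof eventually_elim
      case (elim y)
      thus ?case using slab_scale[OF e, of "1 - y"] by (auto simp: indicator_def D_def)
    qed
  qed simp
  also have "\<dots> = (\<integral>\<^sup>+y. slab e (1 - \<bar>y\<bar>) \<partial>lborel)"
  proof (rule nn_integral_even[symmetric])
    show "(\<lambda>y. slab e (1 - \<bar>y\<bar>)) \<in> borel_measurable borel"
      unfolding sl[symmetric] by measurable
  qed simp
  also have "\<dots> = (\<integral>\<^sup>+x. H (off_axis e x) (x \<bullet> e) \<partial>lborel)"
    by (subst nn_integral_slab) (auto simp: e sl)
  also have "\<dots> \<le> (\<integral>\<^sup>+x. indicator (cball (0::'a) 1) x \<partial>lborel)"
  proof (rule nn_integral_mono)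
    fix x :: 'a
    show "H (off_axis e x) (x \<bullet> e) \<le> indicator (cball 0 1) x"
      using norm_le_off_axis[OF e, of x] by (auto simp: H_def indicator_def)
  qed
  finally show ?thesis by (simp add: D_def mult_left_mono)
qed

text \<open>The ball lies in the cylinder of radius 1 over the heights from -1 to 1, all of whose
  sections have size \<open>slab e 1\<close>.\<close>

lemma nn_integral_cball_le_slab:
  fixes e :: "'a::euclidean_space" and \<phi> :: "real \<Rightarrow> ennreal"
  assumes e: "norm e = 1" and [measurable]: "\<phi> \<in> borel_measurable borel"
  shows "(\<integral>\<^sup>+x. \<phi> (x \<bullet> e) * indicator (cball 0 1) x \<partial>lborel)
    \<le> (\<integral>\<^sup>+y. \<phi> y * indicator {-1..1} y \<partial>lborel) * slab e 1"
proof -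
  define H :: "'a \<Rightarrow> real \<Rightarrow> ennreal" where
    "H z y = \<phi> y * indicator {-1..1} y * indicator {..1} (norm z)" for z y
  have [measurable]: "(\<lambda>(z, y). H z y) \<in> borel_measurable (borel \<Otimes>\<^sub>M borel)"
    unfolding H_def by measurable
  have "(\<integral>\<^sup>+x. \<phi> (x \<bullet> e) * indicator (cball 0 1) x \<partial>lborel) \<le> (\<integral>\<^sup>+x. H (off_axis e x) (x \<bullet> e) \<partial>lborel)"
  proof (intro nn_integral_mono)
    fix x :: 'a
    have "\<bar>x \<bullet> e\<bar> \<le> norm x" using Cauchy_Schwarz_ineq2[of x e] e by simp
    thus "\<phi> (x \<bullet> e) * indicator (cball 0 1) x \<le> H (off_axis e x) (x \<bullet> e)"
      using norm_off_axis_le[OF e, of x] by (auto simp: H_def indicator_def)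
  qed
  also have "\<dots> = (\<integral>\<^sup>+y. \<phi> y * indicator {-1..1} y * slab e 1 \<partial>lborel)"
  proof (subst nn_integral_slab, goal_cases)
    case 3
    show ?case unfolding slab_def H_def
      by (subst nn_integral_cmult[symmetric]) (auto simp: mult_ac)
  qed (use e in auto)
  finally show ?thesis by (simp add: nn_integral_multc)
qed

text \<open>Inside the ball \<open>\<bar>x \<bullet> e\<bar> \<le> \<bar>sgn x \<bullet>
  e\<bar>\<close>, so an integrand decreasing in the modulus only grows when \<open>sgn x\<close> is
  replaced by \<open>x\<close>. The height of \<open>x\<close> then has density at most half the
  dimension, and folding it to its modulus doubles this.\<close>

lemma nn_integral_uniform_sphere_le:
  fixes e :: "'a::euclidean_space" and \<phi> :: "real \<Rightarrow> ennreal"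
  assumes e: "norm e = 1" and [measurable]: "\<phi> \<in> borel_measurable borel"
    and anti: "\<And>x y. \<bar>x\<bar> \<le> \<bar>y\<bar> \<Longrightarrow> \<phi> y \<le> \<phi> x"
  shows "(\<integral>\<^sup>+v. \<phi> (v \<bullet> e) \<partial>uniform_sphere)
    \<le> ennreal (real DIM('a)) * (\<integral>\<^sup>+y. \<phi> y * indicator {0..1} y \<partial>lborel)"
proof -
  define V where "V = emeasure lborel (cball (0::'a) 1)"
  define J where "J = (\<integral>\<^sup>+y. \<phi> y * indicator {0..1} y \<partial>lborel)"
  have V: "V \<noteq> 0" "V \<noteq> \<top>"
    unfolding V_def using less_imp_neq[OF unit_ball_vol_pos[of "real DIM('a)"]]
    by (simp_all add: emeasure_cball)
  have "(\<integral>\<^sup>+y. \<phi> y * indicator {-1..1} y \<partial>lborel)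
      = 2 * (\<integral>\<^sup>+y. \<phi> y * indicator {-1..1} y * indicator {0..} y \<partial>lborel)"
    \<comment> \<open>Evenness of \<open>\<phi>\<close> is \<open>anti\<close> applied in both
      directions to numbers of equal modulus.\<close>
    by (rule nn_integral_even) (auto intro!: antisym anti simp: indicator_def)
  also have "(\<integral>\<^sup>+y. \<phi> y * indicator {-1..1} y * indicator {0..} y \<partial>lborel) = J"
    unfolding J_def by (intro nn_integral_cong) (auto simp: indicator_def)
  finally have even: "(\<integral>\<^sup>+y. \<phi> y * indicator {-1..1} y \<partial>lborel) = 2 * J" .
  have "(\<integral>\<^sup>+v. \<phi> (v \<bullet> e) \<partial>uniform_sphere) = (\<integral>\<^sup>+x. \<phi> (sgn x \<bullet> e) \<partial>uniform_measure lborel (cball 0 1))"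
    unfolding uniform_sphere_def by (rule nn_integral_distr) auto
  also have "\<dots> = (\<integral>\<^sup>+x. \<phi> (sgn x \<bullet> e) * indicator (cball 0 1) x \<partial>lborel) / V"
    unfolding V_def by (rule nn_integral_uniform_measure) auto
  also have "(\<integral>\<^sup>+x. \<phi> (sgn x \<bullet> e) * indicator (cball 0 1) x \<partial>lborel)
      \<le> (\<integral>\<^sup>+x. \<phi> (x \<bullet> e) * indicator (cball 0 1) x \<partial>lborel)"
  proof (intro nn_integral_mono)
    fix x :: 'a
    have "\<bar>x \<bullet> e\<bar> \<le> \<bar>sgn x \<bullet> e\<bar>" if "norm x \<le> 1"
    proof (cases "x = 0")
      case False
      hence "1 * \<bar>x \<bullet> e\<bar> \<le> inverse (norm x) * \<bar>x \<bullet> e\<bar>"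
        using that by (intro mult_right_mono) (auto simp: one_le_inverse)
      thus ?thesis by (simp add: sgn_div_norm abs_mult)
    qed simp
    thus "\<phi> (sgn x \<bullet> e) * indicator (cball 0 1) x \<le> \<phi> (x \<bullet> e) * indicator (cball 0 1) x"
      by (auto intro!: anti simp: indicator_def)
  qed
  also have "\<dots> \<le> 2 * J * slab e 1"
    using nn_integral_cball_le_slab[OF e, of \<phi>] by (simp add: even)
  also have "\<dots> = J * (2 * slab e 1)" by (simp add: mult_ac)
  also have "\<dots> \<le> J * (ennreal (real DIM('a)) * V)"
    unfolding V_def by (intro mult_left_mono emeasure_cball_ge_slab e) simp
  finally have "(\<integral>\<^sup>+v. \<phi> (v \<bullet> e) \<partial>uniform_sphere) \<le> J * (ennreal (real DIM('a)) * V) / V"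
    by (simp add: divide_right_mono_ennreal)
  also have "\<dots> = J * ennreal (real DIM('a))"
    using V by (simp add: ennreal_mult_divide_eq mult.assoc[symmetric])
  finally show ?thesis by (simp add: J_def mult_ac)
qed

section \<open>The two loss integrals over the sphere\<close>

lemma prob_space_uniform_sphere: "prob_space (uniform_sphere :: 'a::euclidean_space measure)"
  unfolding uniform_sphere_def
proof (rule prob_space.prob_space_distr)
  have "unit_ball_vol (real DIM('a)) \<noteq> 0"
    using less_imp_neq[OF unit_ball_vol_pos[of "real DIM('a)"]] by simp
  thus "prob_space (uniform_measure lborel (cball (0::'a) 1))"
    by (intro prob_space_uniform_measure) (auto simp: emeasure_cball)
qed simp

lemma sets_uniform_sphere [measurable_cong, simp]: "sets uniform_sphere = sets borel"
  by (simp add: uniform_sphere_def)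

lemma space_uniform_sphere [simp]: "space uniform_sphere = UNIV"
  by (simp add: uniform_sphere_def)

text \<open>Splitting at scale \<open>1 / a\<close> replaces the dimension \<open>a\<close>, which the density bound alone would give,
  by \<open>ln a\<close>.\<close>

lemma one_minus_powr_le:
  fixes a b s :: real
  assumes "a \<ge> 1" "b \<ge> 0" "s > 0"
  shows "1 - b powr s \<le> s * ln a + max 0 (1 - (a * b) powr s)"
proof -
  define z where "z = (a * b) powr s"
  define c where "c = a powr - s"
  have c: "0 < c" "c \<le> 1"
    using assms unfolding c_def by (auto simp: powr_minus_divide ge_one_powr_ge_zero)
  have "1 - c \<le> s * ln a"
    using exp_ge_add_one_self[of "- s * ln a"] assms by (simp add: c_def powr_def)
  moreover have "b powr s = c * z"
    using assms by (simp add: z_def c_def powr_mult powr_minus)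
  moreover have "z \<ge> 0" by (simp add: z_def)
  moreover have "1 - c * z \<le> (1 - c) + max 0 (1 - z)"
  proof (cases "z \<le> 1")
    case True
    hence "(1 - c) * z \<le> (1 - c) * 1" using c by (intro mult_left_mono) auto
    thus ?thesis using True by (simp add: algebra_simps)
  next
    case False
    hence "c * 1 \<le> c * z" using c by (intro mult_left_mono) auto
    thus ?thesis by simp
  qed
  ultimately show ?thesis unfolding z_def by linarith
qed

text \<open>After the splitting, the second term vanishes for
  \<open>\<bar>y\<bar> \<ge> 1 / a\<close>. Its integral over the remaining interval of length
  \<open>1 / a\<close> is at most \<open>s / a\<close>, so the density bound \<open>a\<close> costs
  only \<open>s\<close> in total.\<close>

lemma nn_integral_uniform_sphere_powr_le:
  fixes e :: "'a::euclidean_space"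
  assumes e: "norm e = 1" and s: "s > 0"
  shows "(\<integral>\<^sup>+v. ennreal (1 - \<bar>v \<bullet> e\<bar> powr s) \<partial>uniform_sphere)
    \<le> ennreal (s * (ln (real DIM('a)) + 1))"
proof -
  interpret prob_space "uniform_sphere :: 'a measure" by (rule prob_space_uniform_sphere)
  define a where "a = real DIM('a)"
  have a: "a \<ge> 1" using DIM_positive[where 'a='a] by (simp add: a_def)
  define \<phi> where "\<phi> y = ennreal (max 0 (1 - (a * \<bar>y\<bar>) powr s))" for y
  have [measurable]: "\<phi> \<in> borel_measurable borel" unfolding \<phi>_def by measurable
  have "((\<lambda>y. 1 - (a * y) powr s) has_integral
      ((1/a - (a * (1/a)) powr (s + 1) / (a * (s + 1))) - (0 - (a * 0) powr (s + 1) / (a * (s + 1))))) {0..1/a}"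
  \<comment> \<open>The derivative of the power is only taken at positive arguments, so the end
    point 0 is left to continuity.\<close>
  proof (rule fundamental_theorem_of_calculus_interior)
    fix y assume "y \<in> {0<..<1/a}"
    hence "((\<lambda>y. y - (a * y) powr (s + 1) / (a * (s + 1))) has_real_derivative
        1 - (s + 1) * (a * y) powr (s + 1 - 1) * a / (a * (s + 1))) (at y)"
      using a s by (auto intro!: derivative_eq_intros simp: powr_diff divide_simps) (simp add: algebra_simps)
    thus "((\<lambda>y. y - (a * y) powr (s + 1) / (a * (s + 1))) has_vector_derivative 1 - (a * y) powr s) (at y)"
      using a s by (simp add: has_real_derivative_iff_has_vector_derivative)
  qed (use a s in \<open>auto intro!: continuous_intros continuous_on_powr'\<close>)
  hence "(\<integral>\<^sup>+y. ennreal (1 - (a * y) powr s) * indicator {0..1/a} y \<partial>lborel) =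
      ennreal ((1/a - (a * (1/a)) powr (s + 1) / (a * (s + 1))) - (0 - (a * 0) powr (s + 1) / (a * (s + 1))))"
    using a s by (intro nn_integral_has_integral_lebesgue') (auto simp: field_simps intro!: powr_le1)
  also have "\<dots> \<le> ennreal (s / a)"
  proof (intro ennreal_leI)
    have "1/a - 1 / (a * (s + 1)) = s / (a * (s + 1))"
    proof -
      have "1/a = (s + 1) / (a * (s + 1))" using s by simp
      thus ?thesis by (simp only: diff_divide_distrib[symmetric]) simp
    qed
    also have "\<dots> \<le> s / a" using a s by (intro divide_left_mono) auto
    finally show "(1/a - (a * (1/a)) powr (s + 1) / (a * (s + 1))) - (0 - (a * 0) powr (s + 1) / (a * (s + 1))) \<le> s / a"
      using a by simp
  qed
  finally have int: "(\<integral>\<^sup>+y. ennreal (1 - (a * y) powr s) * indicator {0..1/a} y \<partial>lborel) \<le> ennreal (s / a)" .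
  have "(\<integral>\<^sup>+y. \<phi> y * indicator {0..1} y \<partial>lborel)
      \<le> (\<integral>\<^sup>+y. ennreal (1 - (a * y) powr s) * indicator {0..1/a} y \<partial>lborel)"
  proof (intro nn_integral_mono)
    fix y
    have "1 \<le> (a * y) powr s" if "1 / a < y"
      using that a s by (intro ge_one_powr_ge_zero) (auto simp: field_simps)
    moreover have "(a * y) powr s \<le> 1" if "0 \<le> y" "y \<le> 1 / a"
      using that a s by (intro powr_le1) (auto simp: field_simps)
    ultimately show "\<phi> y * indicator {0..1} y \<le> ennreal (1 - (a * y) powr s) * indicator {0..1/a} y"
      by (cases "y \<le> 1 / a") (auto simp: \<phi>_def indicator_def max_def)
  qed
  with int have int: "(\<integral>\<^sup>+y. \<phi> y * indicator {0..1} y \<partial>lborel) \<le> ennreal (s / a)" by (rule order_trans[rotated])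
  have "(\<integral>\<^sup>+v. \<phi> (v \<bullet> e) \<partial>uniform_sphere) \<le> ennreal a * (\<integral>\<^sup>+y. \<phi> y * indicator {0..1} y \<partial>lborel)"
    unfolding a_def
  proof (rule nn_integral_uniform_sphere_le[OF e])
    fix x y :: real assume "\<bar>x\<bar> \<le> \<bar>y\<bar>"
    hence "(a * \<bar>x\<bar>) powr s \<le> (a * \<bar>y\<bar>) powr s"
      using a s by (intro powr_mono2) auto
    thus "\<phi> y \<le> \<phi> x" unfolding \<phi>_def by (intro ennreal_leI) auto
  qed simp
  also have "\<dots> \<le> ennreal a * ennreal (s / a)"
    by (intro mult_left_mono int) simp
  also have "\<dots> = ennreal s" using a s by (simp add: ennreal_mult[symmetric])
  finally have \<phi>: "(\<integral>\<^sup>+v. \<phi> (v \<bullet> e) \<partial>uniform_sphere) \<le> ennreal s" .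
  have "(\<integral>\<^sup>+v. ennreal (1 - \<bar>v \<bullet> e\<bar> powr s) \<partial>uniform_sphere)
      \<le> (\<integral>\<^sup>+v. ennreal (s * ln a) + \<phi> (v \<bullet> e) \<partial>uniform_sphere)"
  proof (intro nn_integral_mono)
    fix v :: 'a
    have "ennreal (1 - \<bar>v \<bullet> e\<bar> powr s) \<le> ennreal (s * ln a + max 0 (1 - (a * \<bar>v \<bullet> e\<bar>) powr s))"
      using a s by (intro ennreal_leI one_minus_powr_le) auto
    thus "ennreal (1 - \<bar>v \<bullet> e\<bar> powr s) \<le> ennreal (s * ln a) + \<phi> (v \<bullet> e)"
      unfolding \<phi>_def using a s by (subst ennreal_plus[symmetric]) (auto simp del: ennreal_plus)
  qed
  also have "\<dots> = ennreal (s * ln a) + (\<integral>\<^sup>+v. \<phi> (v \<bullet> e) \<partial>uniform_sphere)"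
    by (subst nn_integral_add) (auto simp: emeasure_space_1[simplified])
  also have "\<dots> \<le> ennreal (s * ln a) + ennreal s" by (intro add_left_mono \<phi>)
  also have "\<dots> = ennreal (s * (ln a + 1))"
    using a s by (simp add: ennreal_plus[symmetric] algebra_simps del: ennreal_plus)
  finally show ?thesis by (simp add: a_def)
qed

text \<open>Supplies the monotonicity in the modulus that
  \<open>nn_integral_uniform_sphere_le\<close> asks for; a nonzero \<open>q\<close> keeps the
  denominators positive.\<close>

lemma div_sqrt_sum_squares_mono:
  fixes b c q :: real
  assumes "0 \<le> b" "b \<le> c" "q \<noteq> 0"
  shows "b / sqrt (b\<^sup>2 + q\<^sup>2) \<le> c / sqrt (c\<^sup>2 + q\<^sup>2)"
proof -
  have pos: "0 < x\<^sup>2 + q\<^sup>2" for x using assms by (simp add: add_nonneg_pos)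
  have "b\<^sup>2 * q\<^sup>2 \<le> c\<^sup>2 * q\<^sup>2" using assms by (intro mult_right_mono power_mono) auto
  hence "(b * sqrt (c\<^sup>2 + q\<^sup>2))\<^sup>2 \<le> (c * sqrt (b\<^sup>2 + q\<^sup>2))\<^sup>2"
    using pos[of b] pos[of c] by (simp add: power_mult_distrib algebra_simps)
  hence "b * sqrt (c\<^sup>2 + q\<^sup>2) \<le> c * sqrt (b\<^sup>2 + q\<^sup>2)"
    by (rule power2_le_imp_le) (use assms in auto)
  thus ?thesis using pos[of b] pos[of c] by (simp add: field_simps)
qed

text \<open>The integrand on the unit interval has the antiderivative
  \<open>y - sqrt (y\<^sup>2 + q\<^sup>2)\<close>, so its integral is
  \<open>1 + q - sqrt (1 + q\<^sup>2)\<close>, which is at most \<open>q\<close>.\<close>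

lemma nn_integral_uniform_sphere_gap_le:
  fixes e :: "'a::euclidean_space"
  assumes e: "norm e = 1" and q: "q > 0"
  shows "(\<integral>\<^sup>+v. ennreal (1 - \<bar>v \<bullet> e\<bar> / sqrt ((v \<bullet> e)\<^sup>2 + q\<^sup>2)) \<partial>uniform_sphere)
    \<le> ennreal (real DIM('a) * q)"
proof -
  define \<phi> where "\<phi> y = ennreal (1 - \<bar>y\<bar> / sqrt (y\<^sup>2 + q\<^sup>2))" for y
  have [measurable]: "\<phi> \<in> borel_measurable borel" unfolding \<phi>_def by measurable
  have pos: "0 < x\<^sup>2 + q\<^sup>2" for x using q by (simp add: add_nonneg_pos)
  have "((\<lambda>y. 1 - y / sqrt (y\<^sup>2 + q\<^sup>2)) has_integral ((1 - sqrt (1\<^sup>2 + q\<^sup>2)) - (0 - sqrt (0\<^sup>2 + q\<^sup>2)))) {0..1}"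
  proof (rule fundamental_theorem_of_calculus)
    fix y :: real
    have "((\<lambda>y. y - sqrt (y\<^sup>2 + q\<^sup>2)) has_real_derivative 1 - y / sqrt (y\<^sup>2 + q\<^sup>2)) (at y within {0..1})"
      using pos[of y] by (auto intro!: derivative_eq_intros simp: field_simps)
    thus "((\<lambda>y. y - sqrt (y\<^sup>2 + q\<^sup>2)) has_vector_derivative 1 - y / sqrt (y\<^sup>2 + q\<^sup>2)) (at y within {0..1})"
      by (simp add: has_real_derivative_iff_has_vector_derivative)
  qed simp
  moreover have "y / sqrt (y\<^sup>2 + q\<^sup>2) \<le> 1" for y
  proof -
    have "y \<le> sqrt (y\<^sup>2 + q\<^sup>2)" by (rule real_le_rsqrt) simp
    thus ?thesis using pos[of y] by (simp add: field_simps)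
  qed
  ultimately have "(\<integral>\<^sup>+y. ennreal (1 - y / sqrt (y\<^sup>2 + q\<^sup>2)) * indicator {0..1} y \<partial>lborel) =
      ennreal ((1 - sqrt (1\<^sup>2 + q\<^sup>2)) - (0 - sqrt (0\<^sup>2 + q\<^sup>2)))"
    by (intro nn_integral_has_integral_lebesgue') auto
  also have "\<dots> \<le> ennreal q"
    using q by (intro ennreal_leI) simp
  also have "(\<integral>\<^sup>+y. ennreal (1 - y / sqrt (y\<^sup>2 + q\<^sup>2)) * indicator {0..1} y \<partial>lborel)
      = (\<integral>\<^sup>+y. \<phi> y * indicator {0..1} y \<partial>lborel)"
    by (intro nn_integral_cong) (auto simp: \<phi>_def indicator_def)
  finally have int: "(\<integral>\<^sup>+y. \<phi> y * indicator {0..1} y \<partial>lborel) \<le> ennreal q" .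
  have "(\<integral>\<^sup>+v. \<phi> (v \<bullet> e) \<partial>uniform_sphere) \<le> ennreal (real DIM('a)) * (\<integral>\<^sup>+y. \<phi> y * indicator {0..1} y \<partial>lborel)"
  proof (rule nn_integral_uniform_sphere_le[OF e])
    fix x y :: real assume "\<bar>x\<bar> \<le> \<bar>y\<bar>"
    thus "\<phi> y \<le> \<phi> x"
      using div_sqrt_sum_squares_mono[of "\<bar>x\<bar>" "\<bar>y\<bar>" q] q
      unfolding \<phi>_def by (intro ennreal_leI) auto
  qed simp
  also have "\<dots> \<le> ennreal (real DIM('a)) * ennreal q"
    by (intro mult_left_mono int) simp
  finally show ?thesis using q by (simp add: \<phi>_def ennreal_mult)
qed

section \<open>Power iterations\<close>

text \<open>The value \<open>u\<^sub>k\<^sup>T A v\<^sub>k\<close> reached by \<open>k\<close> power iterations started at \<open>v\<close>; it is \<open>0\<close> when the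
  iteration breaks down, thanks to \<open>x / 0 = 0\<close>.\<close>

definition power_ratio :: "real^'m^'d \<Rightarrow> nat \<Rightarrow> real^'m \<Rightarrow> real" where
  "power_ratio A k v = norm ((gram A ^^ k) v) / norm (A *v ((gram A ^^ (k - 1)) v))"

lemma power_ratio_nonneg: "0 \<le> power_ratio A k v"
  by (simp add: power_ratio_def)

text \<open>Until a breakdown, \<open>v k\<close> is a positive multiple of the \<open>k\<close>-th
  Gram power applied to \<open>v 0\<close>, and the two sides agree. After a breakdown the vectors
  are arbitrary, but the ratio is then 0 while the right-hand side is a norm; hence an
  inequality.\<close>

lemma power_iteration_ge:
  fixes A :: "real^'m^'d"
  assumes norm: "\<And>k. k < K \<Longrightarrow> normalizes (A *v v k) (u (Suc k)) \<and>
      normalizes (transpose A *v u (Suc k)) (v (Suc k))"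
    and K: "K \<ge> 1"
  shows "power_ratio A K (v 0) \<le> u K \<bullet> (A *v v K)"
proof -
  define K' where "K' = K - 1"
  have K': "K = Suc K'" "K' < K" using K by (simp_all add: K'_def)
  have iter: "\<exists>c>0. v k = c *\<^sub>R (gram A ^^ k) (v 0)" if "k < K" "A *v ((gram A ^^ k) (v 0)) \<noteq> 0" for k
    using that
  proof (induction k)
    case 0
    show ?case by (intro exI[of _ 1]) simp
  next
    case (Suc k)
    let ?x = "(gram A ^^ k) (v 0)"
    have "gram A ?x \<noteq> 0" using Suc.prems by auto
    hence Ax: "A *v ?x \<noteq> 0" by auto
    then obtain c where c: "c > 0" "v k = c *\<^sub>R ?x" using Suc by auto
    have "u (Suc k) = (A *v v k) /\<^sub>R norm (A *v v k)"
      using norm[of k] Suc.prems c Ax by (simp add: normalizes_def matrix_vector_mult_scaleR)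
    hence "u (Suc k) = (inverse (norm (A *v v k)) * c) *\<^sub>R (A *v ?x)"
      by (simp add: c matrix_vector_mult_scaleR)
    moreover have "inverse (norm (A *v v k)) * c > 0"
      using c Ax by (simp add: matrix_vector_mult_scaleR)
    ultimately obtain d where d: "d > 0" "u (Suc k) = d *\<^sub>R (A *v ?x)" by blast
    hence Au: "transpose A *v u (Suc k) = d *\<^sub>R gram A ?x" by (simp add: matrix_vector_mult_scaleR)
    hence "v (Suc k) = (d / norm (d *\<^sub>R gram A ?x)) *\<^sub>R gram A ?x"
      using norm[of k] Suc.prems d \<open>gram A ?x \<noteq> 0\<close> by (simp add: normalizes_def divide_inverse_commute)
    thus ?case using d \<open>gram A ?x \<noteq> 0\<close> by (intro exI[of _ "d / norm (d *\<^sub>R gram A ?x)"]) simp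
  qed
  \<comment> \<open>Since \<open>v K\<close> normalizes \<open>transpose A *v u K\<close>, pairing
    the two gives the norm; if the latter vector is zero, both sides vanish for any unit vector
    chosen.\<close>
  have "u K \<bullet> (A *v v K) = (transpose A *v u K) \<bullet> v K" by (simp add: inner_transpose)
  also have "\<dots> = norm (transpose A *v u K)"
    using norm[OF K'(2)] unfolding K'(1)[symmetric] normalizes_def
    by (cases "transpose A *v u K = 0") (auto simp: power2_norm_eq_inner[symmetric] power2_eq_square)
  finally have out: "u K \<bullet> (A *v v K) = norm (transpose A *v u K)" .
  let ?x = "(gram A ^^ K') (v 0)"
  show ?thesis
  proof (cases "A *v ?x = 0")
    case True
    thus ?thesis by (simp add: power_ratio_def K'_def out)
  next
    case False
    then obtain c where c: "c > 0" "v K' = c *\<^sub>R ?x" using iter K' by blast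
    have "u K = (A *v v K') /\<^sub>R norm (A *v v K')"
      using norm[OF K'(2)] c False K' by (simp add: normalizes_def matrix_vector_mult_scaleR)
    hence "u K = (A *v ?x) /\<^sub>R norm (A *v ?x)"
      using c by (simp add: matrix_vector_mult_scaleR)
    thus ?thesis unfolding out power_ratio_def by (simp add: K' matrix_vector_mult_scaleR divide_inverse_commute)
  qed
qed

text \<open>Quotients of consecutive terms increase, so each factor of the telescoping product is at
  most the last one. Once a term is 0 all later ones are, which makes the convention
  \<open>x / 0 = 0\<close> harmless.\<close>

lemma log_convex_le_ratio_power:
  fixes N :: "nat \<Rightarrow> real"
  assumes nonneg: "\<And>j. 0 \<le> N j" and conv: "\<And>j. (N (Suc j))\<^sup>2 \<le> N j * N (Suc (Suc j))"
  shows "N (Suc n) \<le> (N (Suc n) / N n) ^ Suc n * N 0"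
proof (induction n)
  have zero: "N (Suc j) = 0" if "N j = 0" for j using conv[of j] that by simp
  case 0
  show ?case using zero[of 0] by (cases "N 0 = 0") auto
  case (Suc n)
  show ?case
  proof (cases "N (Suc n) = 0")
    case True
    thus ?thesis using zero[of "Suc n"] by simp
  next
    case False
    hence pos: "N (Suc n) > 0" "N n > 0" using zero[of n] nonneg by (auto simp: order_less_le)
    define r where "r = N (Suc (Suc n)) / N (Suc n)"
    have r: "r \<ge> 0" by (simp add: r_def nonneg)
    have "N (Suc n) / N n \<le> r"
      using conv[of n] pos by (simp add: r_def power2_eq_square field_simps)
    hence "(N (Suc n) / N n) ^ Suc n * N 0 \<le> r ^ Suc n * N 0"
      using pos nonneg by (intro mult_right_mono power_mono) auto
    with Suc.IH have "N (Suc n) \<le> r ^ Suc n * N 0" by (rule order_trans)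
    hence "r * N (Suc n) \<le> r * (r ^ Suc n * N 0)" using r by (rule mult_left_mono)
    thus ?thesis using pos by (simp add: r_def)
  qed
qed

text \<open>The norms of \<open>v, A v, A\<^sup>T A v, A A\<^sup>T A v, \<dots>\<close> are log-convex by Cauchy--Schwarz, so their last
  quotient is at least their geometric mean.\<close>

lemma norm_gram_power_le:
  fixes A :: "real^'m^'d"
  shows "norm ((gram A ^^ Suc k) v) \<le> power_ratio A (Suc k) v ^ (2 * Suc k) * norm v"
proof -
  define N where "N j = (if even j then norm ((gram A ^^ (j div 2)) v)
    else norm (A *v (gram A ^^ (j div 2)) v))" for j
  have "N (Suc (Suc (2 * k))) \<le> (N (Suc (Suc (2 * k))) / N (Suc (2 * k))) ^ Suc (Suc (2 * k)) * N 0"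
  proof (rule log_convex_le_ratio_power)
    fix j
    let ?x = "(gram A ^^ (j div 2)) v"
    have 1: "(norm (A *v ?x))\<^sup>2 \<le> norm ?x * norm (gram A ?x)"
      unfolding inner_gram_self[symmetric] by (rule norm_cauchy_schwarz)
    have "(norm (gram A ?x))\<^sup>2 = (A *v gram A ?x) \<bullet> (A *v ?x)"
      unfolding power2_norm_eq_inner by (metis inner_gram inner_commute)
    also have "\<dots> \<le> norm (A *v ?x) * norm (A *v gram A ?x)"
      using norm_cauchy_schwarz[of "A *v gram A ?x" "A *v ?x"] by (simp add: mult.commute)
    finally have 2: "(norm (gram A ?x))\<^sup>2 \<le> norm (A *v ?x) * norm (A *v gram A ?x)" .
    show "(N (Suc j))\<^sup>2 \<le> N j * N (Suc (Suc j))"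
      using 1 2 by (cases "even j") (simp_all add: N_def)
  qed (simp add: N_def)
  thus ?thesis by (simp add: N_def power_ratio_def)
qed

lemma gram_power_inner:
  fixes A :: "real^'m^'d"
  assumes "gram A e = \<sigma>\<^sup>2 *\<^sub>R e"
  shows "(gram A ^^ k) v \<bullet> e = \<sigma> ^ (2 * k) * (v \<bullet> e)"
proof (induction k)
  case (Suc k)
  have "(gram A ^^ Suc k) v \<bullet> e = (gram A ^^ k) v \<bullet> gram A e" by (simp add: gram_sym)
  thus ?case using Suc by (simp add: assms power2_eq_square)
qed simp

lemma norm_gram_power_ge:
  fixes A :: "real^'m^'d"
  assumes "norm e = 1" "gram A e = \<sigma>\<^sup>2 *\<^sub>R e" "\<sigma> \<ge> 0"
  shows "\<sigma> ^ (2 * k) * \<bar>v \<bullet> e\<bar> \<le> norm ((gram A ^^ k) v)"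
  using Cauchy_Schwarz_ineq2[of "(gram A ^^ k) v" e] assms
  by (simp add: gram_power_inner[OF assms(2)] abs_mult)

text \<open>The component along \<open>e\<close> grows by exactly \<open>\<sigma>\<^sup>2\<close>
  per Gram step, so it bounds the \<open>K\<close>-th Gram power from below, while log-convexity
  bounds the same norm by the ratio to the power \<open>2 * K\<close>. Taking roots gives the
  claim.\<close>

lemma power_ratio_ge_powr:
  fixes A :: "real^'m^'d"
  assumes e: "norm e = 1" "gram A e = \<sigma>\<^sup>2 *\<^sub>R e" and \<sigma>: "\<sigma> > 0" and v: "norm v \<le> 1" and K: "K \<ge> 1"
  shows "\<sigma> * \<bar>v \<bullet> e\<bar> powr (1 / (2 * real K)) \<le> power_ratio A K v"
proof -
  define r where "r = power_ratio A K v / \<sigma>"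
  have r: "r \<ge> 0" using \<sigma> by (simp add: r_def power_ratio_nonneg)
  obtain k where k: "K = Suc k" using K by (cases K) auto
  have "\<sigma> ^ (2 * K) * \<bar>v \<bullet> e\<bar> \<le> norm ((gram A ^^ K) v)"
    using e \<sigma> by (intro norm_gram_power_ge) auto
  also have "\<dots> \<le> power_ratio A K v ^ (2 * K) * norm v"
    using norm_gram_power_le k by metis
  also have "\<dots> \<le> power_ratio A K v ^ (2 * K) * 1"
    using v by (intro mult_left_mono) (auto simp: power_ratio_nonneg)
  finally have "\<bar>v \<bullet> e\<bar> \<le> r ^ (2 * K)"
    using \<sigma> by (simp add: r_def power_divide field_simps)
  hence "\<bar>v \<bullet> e\<bar> powr (1 / (2 * real K)) \<le> (r ^ (2 * K)) powr (1 / (2 * real K))"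
    by (intro powr_mono2) auto
  also have "\<dots> = r"
  proof (cases "r = 0")
    case False
    hence "r > 0" using r by simp
    hence "(r ^ (2 * K)) powr (1 / (2 * real K)) = (r powr real (2 * K)) powr (1 / (2 * real K))"
      by (subst powr_realpow) auto
    also have "\<dots> = r" using \<open>r > 0\<close> K by (simp add: powr_powr)
    finally show ?thesis .
  qed (use K in simp)
  finally show ?thesis using \<sigma> by (simp add: r_def field_simps)
qed

text \<open>The numerator is bounded below by the component along \<open>e\<close> alone. In the
  denominator the perpendicular part has shrunk relative to \<open>\<sigma>\<close> by
  \<open>\<beta>\<close> in each of \<open>2 * (K - 1)\<close> half steps and once more under the
  final \<open>A\<close>, whence the exponent \<open>2 * K - 1\<close>.\<close>

lemma power_ratio_ge_gap:
  fixes A :: "real^'m^'d"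
  assumes e: "norm e = 1" "gram A e = \<sigma>\<^sup>2 *\<^sub>R e" and \<sigma>: "\<sigma> > 0" and v: "norm v \<le> 1" and K: "K \<ge> 1"
    and \<beta>: "\<beta> > 0" and gap: "\<And>x. x \<bullet> e = 0 \<Longrightarrow> norm (A *v x) \<le> \<beta> * \<sigma> * norm x"
  shows "\<sigma> * (\<bar>v \<bullet> e\<bar> / sqrt ((v \<bullet> e)\<^sup>2 + (\<beta> ^ (2 * K - 1))\<^sup>2)) \<le> power_ratio A K v"
proof -
  obtain k where k: "K = Suc k" using K by (cases K) auto
  define a where "a = v \<bullet> e"
  define w where "w = v - a *\<^sub>R e"
  define q where "q = \<beta> ^ (2 * k + 1)"
  have ee: "e \<bullet> e = 1" using e by (simp add: norm_eq_1)
  have "(norm w)\<^sup>2 = (norm v)\<^sup>2 - a\<^sup>2"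
    unfolding w_def power2_norm_eq_inner a_def
    by (simp add: inner_simps ee power2_eq_square inner_commute)
  hence "(norm w)\<^sup>2 \<le> (norm v)\<^sup>2" by simp
  hence "norm w \<le> norm v" by (rule power2_le_imp_le) simp
  hence w1: "norm w \<le> 1" using v by simp
  have "w \<bullet> e = 0" by (simp add: w_def a_def inner_simps ee)
  hence perp: "(gram A ^^ j) w \<bullet> e = 0" for j by (simp add: gram_power_inner[OF e(2)])
  \<comment> \<open>The gap hypothesis concerns \<open>A\<close> only, not its transpose; writing
    the squared norm as \<open>(A *v gram A x) \<bullet> (A *v x)\<close> lets it be applied twice,
    as \<open>gram A x\<close> is again perpendicular to \<open>e\<close>.\<close>
  have gram_le: "norm (gram A x) \<le> (\<beta> * \<sigma>)\<^sup>2 * norm x" if "x \<bullet> e = 0" for x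
  proof (cases "gram A x = 0")
    case False
    have "gram A x \<bullet> e = 0" using that e by (simp add: gram_sym)
    have "norm (gram A x) * norm (gram A x) = (A *v gram A x) \<bullet> (A *v x)"
      unfolding power2_eq_square[symmetric] power2_norm_eq_inner by (metis inner_gram inner_commute)
    also have "\<dots> \<le> norm (A *v gram A x) * norm (A *v x)" by (rule norm_cauchy_schwarz)
    also have "\<dots> \<le> (\<beta> * \<sigma> * norm (gram A x)) * (\<beta> * \<sigma> * norm x)"
      using gap[OF that] gap[OF \<open>gram A x \<bullet> e = 0\<close>] \<beta> \<sigma> by (intro mult_mono) auto
    finally have "norm (gram A x) * norm (gram A x) \<le> norm (gram A x) * ((\<beta> * \<sigma>)\<^sup>2 * norm x)"
      by (simp add: power2_eq_square mult_ac)
    thus ?thesis using False by simp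
  qed simp
  have pow_le: "norm ((gram A ^^ j) w) \<le> (\<beta> * \<sigma>) ^ (2 * j) * norm w" for j
  proof (induction j)
    case (Suc j)
    have "norm ((gram A ^^ Suc j) w) \<le> (\<beta> * \<sigma>)\<^sup>2 * norm ((gram A ^^ j) w)"
      using gram_le[OF perp] by simp
    also have "\<dots> \<le> (\<beta> * \<sigma>)\<^sup>2 * ((\<beta> * \<sigma>) ^ (2 * j) * norm w)"
      by (intro mult_left_mono Suc) simp
    finally show ?case by (simp add: power2_eq_square mult_ac)
  qed simp
  have dec: "(gram A ^^ j) v = (a * \<sigma> ^ (2 * j)) *\<^sub>R e + (gram A ^^ j) w" for j
  proof (induction j)
    case (Suc j)
    have "(gram A ^^ Suc j) v = (a * \<sigma> ^ (2 * j)) *\<^sub>R gram A e + gram A ((gram A ^^ j) w)"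
      by (simp add: Suc linear_add[OF linear_gram] linear_scale[OF linear_gram])
    thus ?case by (simp add: e power2_eq_square mult_ac)
  qed (simp add: w_def)
  let ?x = "(gram A ^^ k) v" and ?y = "(gram A ^^ k) w"
  have "norm (A *v ?y) \<le> (\<beta> * \<sigma>) * norm ?y" by (rule gap[OF perp])
  also have "\<dots> \<le> (\<beta> * \<sigma>) * ((\<beta> * \<sigma>) ^ (2 * k) * norm w)"
    using \<beta> \<sigma> by (intro mult_left_mono pow_le) auto
  also have "\<dots> \<le> (\<beta> * \<sigma>) * ((\<beta> * \<sigma>) ^ (2 * k) * 1)"
    using \<beta> \<sigma> w1 by (intro mult_left_mono) auto
  finally have y: "norm (A *v ?y) \<le> \<sigma> ^ (2 * k + 1) * q"
    by (simp add: q_def power_mult_distrib mult_ac)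
  have "(A *v e) \<bullet> (A *v ?y) = 0"
    using perp[of k] inner_gram[of A e ?y] e by (simp add: inner_commute)
  moreover have "(A *v e) \<bullet> (A *v e) = \<sigma>\<^sup>2" using inner_gram[of A e e] e ee by simp
  ultimately have "(norm (A *v ?x))\<^sup>2 = (a * \<sigma> ^ (2 * k))\<^sup>2 * \<sigma>\<^sup>2 + (norm (A *v ?y))\<^sup>2"
    unfolding dec[of k] power2_norm_eq_inner
    by (simp add: matrix_vector_right_distrib matrix_vector_mult_scaleR inner_simps inner_commute
        power2_eq_square)
  also have "\<dots> \<le> (a * \<sigma> ^ (2 * k))\<^sup>2 * \<sigma>\<^sup>2 + (\<sigma> ^ (2 * k + 1) * q)\<^sup>2"
    using y by (intro add_left_mono power_mono) auto
  also have "\<dots> = (\<sigma> ^ (2 * k + 1))\<^sup>2 * (a\<^sup>2 + q\<^sup>2)"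
    by (simp add: power_mult_distrib algebra_simps)
  finally have "norm (A *v ?x) \<le> sqrt ((\<sigma> ^ (2 * k + 1))\<^sup>2 * (a\<^sup>2 + q\<^sup>2))"
    by (rule real_le_rsqrt)
  hence den: "norm (A *v ?x) \<le> \<sigma> ^ (2 * k + 1) * sqrt (a\<^sup>2 + q\<^sup>2)"
    using \<sigma> by (simp add: real_sqrt_mult)
  have num: "\<sigma> ^ (2 * Suc k) * \<bar>a\<bar> \<le> norm ((gram A ^^ Suc k) v)"
    unfolding a_def using e \<sigma> by (intro norm_gram_power_ge) auto
  have pos: "a\<^sup>2 + q\<^sup>2 > 0" using \<beta> by (simp add: q_def add_nonneg_pos)
  have "\<sigma> * (\<bar>a\<bar> / sqrt (a\<^sup>2 + q\<^sup>2)) \<le> power_ratio A (Suc k) v"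
  \<comment> \<open>With a vanishing denominator the ratio is 0 by convention, but then the
    numerator bound forces \<open>a = 0\<close>.\<close>
  proof (cases "A *v ?x = 0")
    case True
    hence "\<sigma> ^ (2 * Suc k) * \<bar>a\<bar> \<le> 0" using num by simp
    moreover have "\<sigma> ^ (2 * Suc k) > 0" using \<sigma> by (rule zero_less_power)
    ultimately have "a = 0" by (simp only: mult_le_0_iff) simp
    thus ?thesis by (simp add: power_ratio_nonneg)
  next
    case False
    have "\<sigma> * (\<bar>a\<bar> / sqrt (a\<^sup>2 + q\<^sup>2)) = \<sigma> ^ (2 * Suc k) * \<bar>a\<bar> / (\<sigma> ^ (2 * k + 1) * sqrt (a\<^sup>2 + q\<^sup>2))"
      using \<sigma> by simp
    also have "\<dots> \<le> norm ((gram A ^^ Suc k) v) / norm (A *v ?x)"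
      using num den False by (intro frac_le) auto
    finally show ?thesis by (simp add: power_ratio_def)
  qed
  thus ?thesis by (simp add: a_def q_def k)
qed

section \<open>Expected error of the power iteration\<close>

lemma AE_uniform_sphere_norm_le: "AE v in (uniform_sphere :: 'a::euclidean_space measure). norm v \<le> 1"
  unfolding uniform_sphere_def by (subst AE_distr_iff) (auto simp: norm_sgn)

text \<open>\<open>ennreal\<close> truncates at 0, so this bounds the expected positive part of the
  error, the quantity used in the recursion.\<close>

lemma nn_integral_power_error_le:
  fixes A :: "real^'m^'d"
  assumes K: "K \<ge> 1"
  shows "(\<integral>\<^sup>+v. ennreal (onorm ((*v) A) - power_ratio A K v) \<partial>uniform_sphere)
    \<le> ennreal (onorm ((*v) A) * ((ln (real CARD('m)) + 1) / (2 * real K)))"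
proof -
  define \<sigma> where "\<sigma> = onorm ((*v) A)"
  have \<sigma>: "\<sigma> \<ge> 0" by (simp add: \<sigma>_def onorm_pos_le)
  obtain e where e: "norm e = 1" "gram A e = \<sigma>\<^sup>2 *\<^sub>R e"
    using top_singular_vector[of A] unfolding \<sigma>_def by blast
  define s where "s = 1 / (2 * real K)"
  have "(\<integral>\<^sup>+v. ennreal (\<sigma> - power_ratio A K v) \<partial>uniform_sphere)
      \<le> (\<integral>\<^sup>+v. ennreal \<sigma> * ennreal (1 - \<bar>v \<bullet> e\<bar> powr s) \<partial>uniform_sphere)"
  proof (rule nn_integral_mono_AE)
    show "AE v in uniform_sphere. ennreal (\<sigma> - power_ratio A K v) \<le> ennreal \<sigma> * ennreal (1 - \<bar>v \<bullet> e\<bar> powr s)"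
      using AE_uniform_sphere_norm_le
    proof eventually_elim
      case (elim v)
      have "\<sigma> * \<bar>v \<bullet> e\<bar> powr s \<le> power_ratio A K v"
        using power_ratio_ge_powr[OF e _ elim K] \<sigma>
        by (cases "\<sigma> = 0") (auto simp: s_def power_ratio_nonneg)
      hence "ennreal (\<sigma> - power_ratio A K v) \<le> ennreal (\<sigma> * (1 - \<bar>v \<bullet> e\<bar> powr s))"
        by (intro ennreal_leI) (simp add: algebra_simps)
      thus ?case using \<sigma> by (simp add: ennreal_mult')
    qed
  qed
  also have "\<dots> = ennreal \<sigma> * (\<integral>\<^sup>+v. ennreal (1 - \<bar>v \<bullet> e\<bar> powr s) \<partial>uniform_sphere)"
    by (rule nn_integral_cmult) simp
  also have "\<dots> \<le> ennreal \<sigma> * ennreal (s * (ln (real CARD('m)) + 1))"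
    using nn_integral_uniform_sphere_powr_le[OF e(1), of s] K
    by (intro mult_left_mono) (auto simp: s_def)
  also have "\<dots> = ennreal (\<sigma> * (s * (ln (real CARD('m)) + 1)))" using \<sigma> by (simp add: ennreal_mult')
  finally show ?thesis by (simp add: \<sigma>_def s_def)
qed

lemma nn_integral_power_error_gap_le:
  fixes A :: "real^'m^'d"
  assumes K: "K \<ge> 1" and \<beta>: "\<beta> > 0"
    and mult: "count (singular_values A) (sing_val A 1) = 1"
    and gap: "sing_val A 2 / sing_val A 1 < \<beta>"
  shows "(\<integral>\<^sup>+v. ennreal (onorm ((*v) A) - power_ratio A K v) \<partial>uniform_sphere)
    \<le> ennreal (onorm ((*v) A) * (real CARD('m) * \<beta> ^ (2 * K - 1)))"
proof -
  define \<sigma> where "\<sigma> = onorm ((*v) A)"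
  have \<sigma>: "\<sigma> \<ge> 0" by (simp add: \<sigma>_def onorm_pos_le)
  obtain e where e: "norm e = 1" "gram A e = \<sigma>\<^sup>2 *\<^sub>R e"
    using top_singular_vector[of A] unfolding \<sigma>_def by blast
  define q where "q = \<beta> ^ (2 * K - 1)"
  have q: "q > 0" using \<beta> by (simp add: q_def)
  have "(\<integral>\<^sup>+v. ennreal (\<sigma> - power_ratio A K v) \<partial>uniform_sphere)
      \<le> (\<integral>\<^sup>+v. ennreal \<sigma> * ennreal (1 - \<bar>v \<bullet> e\<bar> / sqrt ((v \<bullet> e)\<^sup>2 + q\<^sup>2)) \<partial>uniform_sphere)"
  proof (rule nn_integral_mono_AE)
    show "AE v in uniform_sphere. ennreal (\<sigma> - power_ratio A K v)
        \<le> ennreal \<sigma> * ennreal (1 - \<bar>v \<bullet> e\<bar> / sqrt ((v \<bullet> e)\<^sup>2 + q\<^sup>2))"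
      using AE_uniform_sphere_norm_le
    proof eventually_elim
      case (elim v)
      have "\<sigma> * (\<bar>v \<bullet> e\<bar> / sqrt ((v \<bullet> e)\<^sup>2 + q\<^sup>2)) \<le> power_ratio A K v"
      proof (cases "\<sigma> = 0")
        case False
        hence pos: "\<sigma> > 0" using \<sigma> by simp
        have "norm (A *v x) \<le> \<beta> * \<sigma> * norm x" if "x \<bullet> e = 0" for x
          using spectral_gap[OF mult gap _ e(1) _ that] e(2) pos unfolding \<sigma>_def by blast
        thus ?thesis unfolding q_def by (rule power_ratio_ge_gap[OF e pos elim K \<beta>])
      qed (simp add: power_ratio_nonneg)
      hence "ennreal (\<sigma> - power_ratio A K v) \<le> ennreal (\<sigma> * (1 - \<bar>v \<bullet> e\<bar> / sqrt ((v \<bullet> e)\<^sup>2 + q\<^sup>2)))"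
        by (intro ennreal_leI) (simp add: algebra_simps)
      thus ?case using \<sigma> by (simp add: ennreal_mult')
    qed
  qed
  also have "\<dots> = ennreal \<sigma> * (\<integral>\<^sup>+v. ennreal (1 - \<bar>v \<bullet> e\<bar> / sqrt ((v \<bullet> e)\<^sup>2 + q\<^sup>2)) \<partial>uniform_sphere)"
    by (rule nn_integral_cmult) simp
  also have "\<dots> \<le> ennreal \<sigma> * ennreal (real CARD('m) * q)"
    using nn_integral_uniform_sphere_gap_le[OF e(1) q] by (intro mult_left_mono) auto
  also have "\<dots> = ennreal (\<sigma> * (real CARD('m) * q))" using \<sigma> by (simp add: ennreal_mult')
  finally show ?thesis by (simp add: \<sigma>_def q_def)
qed

section \<open>Frank--Wolfe steps\<close>

lemma continuous_on_matrix_vector_mult [continuous_intros]: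
  fixes f :: "'a::topological_space \<Rightarrow> real^'m^'d"
  assumes "continuous_on S f" "continuous_on S g"
  shows "continuous_on S (\<lambda>x. f x *v g x)"
  unfolding matrix_vector_mult_def using assms by (intro continuous_intros)

lemma continuous_on_matrix_transpose [continuous_intros]:
  fixes f :: "'a::topological_space \<Rightarrow> real^'m^'d"
  assumes "continuous_on S f"
  shows "continuous_on S (\<lambda>x. transpose (f x))"
  unfolding transpose_def using assms by (intro continuous_intros)

lemma continuous_on_gram_power:
  fixes f :: "'a::topological_space \<Rightarrow> real^'m^'d"
  assumes "continuous_on S f" "continuous_on S g"
  shows "continuous_on S (\<lambda>x. (gram (f x) ^^ k) (g x))"
proof (induction k)
  case (Suc k)
  thus ?case using assms by (auto intro!: continuous_intros)
qed (use assms in simp)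

text \<open>Joint measurability in matrix and starting vector. The ratio can be discontinuous where
  the iteration breaks down, but it is a quotient of continuous functions and hence Borel.\<close>

lemma borel_measurable_power_error:
  "(\<lambda>p :: (real^'m^'d) \<times> (real^'m). onorm ((*v) (fst p)) - power_ratio (fst p) k (snd p))
    \<in> borel_measurable borel"
  unfolding power_ratio_def
  by (intro borel_measurable_diff borel_measurable_divide borel_measurable_continuous_onI
      continuous_on_compose2[OF continuous_on_onorm] continuous_intros continuous_on_gram_power) auto

section \<open>Gradients and tangent planes\<close>

lemma GDERIV_grad:
  fixes f :: "real^'m^'d \<Rightarrow> real"
  assumes "f differentiable (at W)"
  shows "GDERIV f W :> grad f W"
proof -
  obtain f' where f': "(f has_derivative f') (at W)" using assms by (auto simp: differentiable_def)
  hence lin: "linear f'" by (rule has_derivative_linear)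
  define D where "D = (\<Sum>b\<in>Basis. f' b *\<^sub>R b)"
  have "f' h = h \<bullet> D" for h
  proof -
    have "f' h = f' (\<Sum>b\<in>Basis. (h \<bullet> b) *\<^sub>R b)" by (simp add: euclidean_representation)
    also have "\<dots> = (\<Sum>b\<in>Basis. (h \<bullet> b) * f' b)" by (simp add: linear_sum[OF lin] linear_scale[OF lin])
    finally show ?thesis by (simp add: D_def inner_sum_right mult.commute)
  qed
  hence "f' = (\<lambda>h. h \<bullet> D)" by blast
  hence "GDERIV f W :> D" using f' by (simp add: gderiv_def)
  moreover have "D' = D" if "GDERIV f W :> D'" for D'
    using has_derivative_unique[of f "\<lambda>h. h \<bullet> D'" W "\<lambda>h. h \<bullet> D"] that \<open>GDERIV f W :> D\<close>
    unfolding gderiv_def by (metis vector_eq_rdot inner_commute)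
  ultimately show ?thesis unfolding grad_def by (metis theI)
qed

lemma grad_eqI:
  fixes f :: "real^'m^'d \<Rightarrow> real"
  assumes "GDERIV f W :> D"
  shows "grad f W = D"
proof -
  have "f differentiable (at W)" using assms by (auto simp: gderiv_def differentiable_def)
  hence "(\<lambda>h. h \<bullet> grad f W) = (\<lambda>h. h \<bullet> D)"
    using GDERIV_grad[of f W] assms has_derivative_unique unfolding gderiv_def by blast
  thus ?thesis by (metis vector_eq_rdot inner_commute)
qed

lemma grad_sum_fun:
  fixes f :: "nat \<Rightarrow> real^'m^'d \<Rightarrow> real"
  assumes "\<And>i. i \<in> J \<Longrightarrow> f i differentiable (at W)"
  shows "grad (sum_fun f J) W = (\<Sum>i\<in>J. grad (f i) W)"
proof (rule grad_eqI)
  have "((\<lambda>W. \<Sum>i\<in>J. f i W) has_derivative (\<lambda>h. \<Sum>i\<in>J. h \<bullet> grad (f i) W)) (at W)"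
    using GDERIV_grad[OF assms] by (intro has_derivative_sum) (auto simp: gderiv_def)
  thus "GDERIV (sum_fun f J) W :> (\<Sum>i\<in>J. grad (f i) W)"
    by (simp add: gderiv_def sum_fun_def[abs_def] inner_sum_right)
qed

lemma sum_matrix_vector_mult: "(\<Sum>j\<in>J. A j *v x) = (\<Sum>j\<in>J. A j) *v x"
  for A :: "'i \<Rightarrow> real^'m^'d"
  by (induction J rule: infinite_finite_induct) (auto simp: matrix_vector_mult_add_rdistrib)

lemma sum_transpose: "(\<Sum>j\<in>J. transpose (A j)) = transpose (\<Sum>j\<in>J. A j)"
  for A :: "'i \<Rightarrow> real^'m^'d"
  by (simp add: vec_eq_iff transpose_def)

text \<open>Restriction to the line through \<open>W\<close> and \<open>V\<close> reduces the claim
  to the tangent inequality for convex functions of one real variable.\<close>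

lemma convex_on_above_tangent:
  fixes F :: "real^'m^'d \<Rightarrow> real"
  assumes conv: "convex_on UNIV F" and G: "GDERIV F W :> G"
  shows "F W + (V - W) \<bullet> G \<le> F V"
proof -
  define \<phi> where "\<phi> t = F (W + t *\<^sub>R (V - W))" for t
  have "convex_on UNIV \<phi>"
  proof (rule convex_onI)
    fix t x y :: real assume t: "0 < t" "t < 1"
    have "W + ((1 - t) *\<^sub>R x + t *\<^sub>R y) *\<^sub>R (V - W)
        = (1 - t) *\<^sub>R (W + x *\<^sub>R (V - W)) + t *\<^sub>R (W + y *\<^sub>R (V - W))"
      by (simp add: algebra_simps)
    thus "\<phi> ((1 - t) *\<^sub>R x + t *\<^sub>R y) \<le> (1 - t) * \<phi> x + t * \<phi> y"
      unfolding \<phi>_def using convex_onD[OF conv, of t] t by simp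
  qed simp
  moreover have "(\<phi> has_derivative (\<lambda>h. (h *\<^sub>R (V - W)) \<bullet> G)) (at 0)"
    unfolding \<phi>_def
    by (rule has_derivative_compose[of "\<lambda>t. W + t *\<^sub>R (V - W)" "\<lambda>h. h *\<^sub>R (V - W)" 0 UNIV F "\<lambda>h. h \<bullet> G"])
      (use G in \<open>auto simp: gderiv_def intro!: derivative_eq_intros\<close>)
  hence "(\<phi> has_field_derivative (V - W) \<bullet> G) (at 0)"
    by (simp add: has_field_derivative_def mult_commute_abs)
  ultimately have "\<phi> 1 - \<phi> 0 \<ge> (V - W) \<bullet> G * (1 - 0)"
    by (intro convex_on_imp_above_tangent[where A = UNIV]) auto
  thus ?thesis by (simp add: \<phi>_def)
qed

section \<open>One Frank-Wolfe step and the recursion\<close>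

lemma fw_step_eq: "fw_step \<mu> W u v \<gamma> = W + \<gamma> *\<^sub>R (- (\<mu> *\<^sub>R outer u v) - W)"
  by (simp add: fw_step_def algebra_simps)

lemma fw_step_in_trace_ball:
  assumes "W \<in> trace_ball \<mu>" "norm u = 1" "norm v = 1" "0 \<le> \<mu>" "0 \<le> \<gamma>" "\<gamma> \<le> 1"
  shows "fw_step \<mu> W u v \<gamma> \<in> trace_ball \<mu>"
proof -
  have "fw_step \<mu> W u v \<gamma> = (1 - \<gamma>) *\<^sub>R W + \<gamma> *\<^sub>R (- (\<mu> *\<^sub>R outer u v))"
    by (simp add: fw_step_def)
  thus ?thesis
    using convexD[OF convex_trace_ball assms(1) scaleR_outer_in_trace_ball[OF assms(2-4)], of "1 - \<gamma>" \<gamma>] assms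
    by simp
qed

lemma fw_step_progress:
  fixes F :: "real^'m^'d \<Rightarrow> real"
  assumes conv: "convex_on UNIV F" and diff: "F differentiable (at W)"
    and bdd: "bdd_above (curvature_set F \<mu>)"
    and W: "W \<in> trace_ball \<mu>" and Wstar: "Wstar \<in> trace_ball \<mu>"
    and uv: "norm u = 1" "norm v = 1" and \<mu>: "\<mu> > 0" and \<gamma>: "0 < \<gamma>" "\<gamma> \<le> 1"
  shows "F (fw_step \<mu> W u v \<gamma>) - F Wstar \<le> (1 - \<gamma>) * (F W - F Wstar)
    + \<gamma> * \<mu> * (onorm ((*v) (grad F W)) - u \<bullet> (grad F W *v v)) + \<gamma>\<^sup>2 / 2 * curvature_const F \<mu>"
proof -
  define G where "G = grad F W"
  define S where "S = - (\<mu> *\<^sub>R outer u v)"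
  define Y where "Y = W + \<gamma> *\<^sub>R (S - W)"
  have S: "S \<in> trace_ball \<mu>" unfolding S_def using uv \<mu> by (intro scaleR_outer_in_trace_ball) auto
  have "2 / \<gamma>\<^sup>2 * (F Y - F W - (Y - W) \<bullet> G) \<in> curvature_set F \<mu>"
    unfolding curvature_set_def G_def using W S \<gamma> Y_def by blast
  hence "2 / \<gamma>\<^sup>2 * (F Y - F W - (Y - W) \<bullet> G) \<le> curvature_const F \<mu>"
    unfolding curvature_const_def by (intro cSup_upper bdd)
  hence curv: "F Y \<le> F W + \<gamma> * ((S - W) \<bullet> G) + \<gamma>\<^sup>2 / 2 * curvature_const F \<mu>"
  proof -
    have "(Y - W) \<bullet> G = \<gamma> * ((S - W) \<bullet> G)" by (simp add: Y_def)
    with \<open>2 / \<gamma>\<^sup>2 * _ \<le> _\<close> show ?thesis using \<gamma> by (simp add: field_simps)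
  qed
  have "F W + (Wstar - W) \<bullet> G \<le> F Wstar"
    unfolding G_def by (intro convex_on_above_tangent conv GDERIV_grad diff)
  moreover have "\<bar>Wstar \<bullet> G\<bar> \<le> onorm ((*v) G) * trace_norm Wstar"
    by (intro abs_inner_le_trace_norm norm_matrix_vector_le_onorm)
  moreover have "\<dots> \<le> onorm ((*v) G) * \<mu>"
    using Wstar by (intro mult_left_mono) (auto simp: trace_ball_def onorm_pos_le)
  moreover have "S \<bullet> G = - (\<mu> * (u \<bullet> (G *v v)))" by (simp add: S_def inner_outer)
  ultimately have "(S - W) \<bullet> G \<le> - (F W - F Wstar) + \<mu> * (onorm ((*v) G) - u \<bullet> (G *v v))"
    by (simp add: inner_simps algebra_simps)
  hence "\<gamma> * ((S - W) \<bullet> G) \<le> \<gamma> * (- (F W - F Wstar) + \<mu> * (onorm ((*v) G) - u \<bullet> (G *v v)))"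
    using \<gamma> by (intro mult_left_mono) auto
  with curv show ?thesis unfolding fw_step_eq S_def[symmetric] Y_def[symmetric] G_def[symmetric]
    by (simp add: algebra_simps)
qed

text \<open>The tangent inequality is tested at \<open>W + X\<close>, where \<open>X\<close> is the
  rank-one matrix built from the top right singular vector and its normalized image. It has trace
  norm at most 1 and pairs with the gradient to the operator norm.\<close>

lemma onorm_grad_le:
  fixes F :: "real^'m^'d \<Rightarrow> real"
  assumes conv: "convex_on UNIV F" and diff: "F differentiable (at W)"
    and L: "L \<ge> 0" and lip: "\<And>W W'. \<bar>F W - F W'\<bar> \<le> L * trace_norm (W - W')"
  shows "onorm ((*v) (grad F W)) \<le> L"
proof -
  define G where "G = grad F W"
  obtain e where e: "norm e = 1" "norm (G *v e) = onorm ((*v) G)"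
    using top_singular_vector[of G] by blast
  define X where "X = outer (sgn (G *v e)) e"
  have "onorm ((*v) G) = X \<bullet> G"
    unfolding X_def inner_outer e(2)[symmetric] by (metis inner_sgn inner_commute)
  also have "\<dots> \<le> F (W + X) - F W"
    using convex_on_above_tangent[OF conv GDERIV_grad[OF diff], of "W + X"] by (simp add: G_def)
  also have "\<dots> \<le> L * trace_norm X" using lip[of "W + X" W] by simp
  also have "\<dots> \<le> L * 1"
    using trace_norm_outer_le[of "sgn (G *v e)" e] e L
    by (intro mult_left_mono) (auto simp: X_def norm_sgn split: if_splits)
  finally show ?thesis by (simp add: G_def)
qed

text \<open>At \<open>t = 0\<close> the coefficient of \<open>h 0\<close> is 0, so the starting
  point is forgotten and the bound holds from \<open>t = 1\<close> on. The induction step comes down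
  to \<open>(t + 1) * (t + 3) \<le> (t + 2)\<^sup>2\<close>.\<close>

lemma fw_recursion:
  fixes h :: "nat \<Rightarrow> real"
  assumes c: "c \<ge> 0"
    and step: "\<And>t. h (Suc t) \<le> (1 - 2 / (real t + 2)) * h t + (2 / (real t + 2))\<^sup>2 / 2 * c"
    and t: "t \<ge> 1"
  shows "h t \<le> 2 * c / (real t + 2)"
  using t
proof (induction t rule: dec_induct)
  case base
  show ?case using step[of 0] c by simp
next
  case (step t)
  have "h (Suc t) \<le> (1 - 2 / (real t + 2)) * (2 * c / (real t + 2)) + (2 / (real t + 2))\<^sup>2 / 2 * c"
    using step by (intro order_trans[OF assms(2)] add_right_mono mult_left_mono) auto
  also have "\<dots> = 2 * c * ((real t + 1) / (real t + 2)\<^sup>2)"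
    by (simp add: divide_simps power2_eq_square) (simp add: algebra_simps)
  also have "\<dots> \<le> 2 * c * (1 / (real t + 3))"
  proof (intro mult_left_mono)
    have "(real t + 1) * (real t + 3) \<le> (real t + 2)\<^sup>2"
      by (simp add: power2_eq_square algebra_simps)
    hence "real t + 1 \<le> (real t + 2)\<^sup>2 / (real t + 3)" by (simp add: pos_le_divide_eq)
    thus "(real t + 1) / (real t + 2)\<^sup>2 \<le> 1 / (real t + 3)"
      by (intro mult_imp_div_pos_le) auto
  qed (use c in simp)
  finally show ?case by (simp add: add.commute)
qed

text \<open>Integrates out the fresh draw while the past is frozen. The joint law is a product
  because it is so on rectangles, where the preimage under \<open>X\<close> belongs to
  \<open>H\<close>.\<close>

lemma (in prob_space) nn_integral_indep_subalgebra:
  fixes X :: "'a \<Rightarrow> 'b::second_countable_topology" and Y :: "'a \<Rightarrow> 'c::second_countable_topology"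
  assumes sub: "subalgebra M H" and X: "X \<in> borel_measurable H" and Y: "Y \<in> borel_measurable M"
    and ind: "indep_set {Y -` B \<inter> space M | B. B \<in> sets borel} (sets H)"
    and g: "g \<in> borel_measurable borel"
  shows "(\<integral>\<^sup>+\<omega>. g (X \<omega>, Y \<omega>) \<partial>M) = (\<integral>\<^sup>+\<omega>. \<integral>\<^sup>+y. g (X \<omega>, y) \<partial>distr M borel Y \<partial>M)"
proof -
  have X'[measurable]: "X \<in> borel_measurable M" by (rule measurable_from_subalg[OF sub X])
  note Y[measurable]
  have g'[measurable]: "g \<in> borel_measurable (borel \<Otimes>\<^sub>M borel)" using g by (simp add: borel_prod)
  interpret DX: prob_space "distr M borel X" by (rule prob_space_distr) simp
  interpret DY: prob_space "distr M borel Y" by (rule prob_space_distr) simp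
  have joint: "distr M borel X \<Otimes>\<^sub>M distr M borel Y = distr M (borel \<Otimes>\<^sub>M borel) (\<lambda>\<omega>. (X \<omega>, Y \<omega>))"
  proof (rule pair_measure_eqI)
    fix A B assume "A \<in> sets (distr M borel X)" "B \<in> sets (distr M borel Y)"
    hence [measurable]: "A \<in> sets borel" "B \<in> sets borel" by simp_all
    have "X -` A \<inter> space M \<in> sets H"
      using measurable_sets[OF X, of A] sub by (simp add: subalgebra_def)
    hence "prob ((Y -` B \<inter> space M) \<inter> (X -` A \<inter> space M)) = prob (Y -` B \<inter> space M) * prob (X -` A \<inter> space M)"
      by (intro indep_setD[OF ind]) auto
    moreover have "(\<lambda>\<omega>. (X \<omega>, Y \<omega>)) -` (A \<times> B) \<inter> space M = (Y -` B \<inter> space M) \<inter> (X -` A \<inter> space M)"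
      by auto
    ultimately show "emeasure (distr M borel X) A * emeasure (distr M borel Y) B
        = emeasure (distr M (borel \<Otimes>\<^sub>M borel) (\<lambda>\<omega>. (X \<omega>, Y \<omega>))) (A \<times> B)"
      by (simp add: emeasure_distr emeasure_eq_measure ennreal_mult mult.commute)
  qed (auto simp: DX.sigma_finite_measure_axioms DY.sigma_finite_measure_axioms intro!: sets_pair_measure_cong)
  have "(\<integral>\<^sup>+\<omega>. g (X \<omega>, Y \<omega>) \<partial>M) = (\<integral>\<^sup>+p. g p \<partial>distr M (borel \<Otimes>\<^sub>M borel) (\<lambda>\<omega>. (X \<omega>, Y \<omega>)))"
    by (subst nn_integral_distr) auto
  also have "\<dots> = (\<integral>\<^sup>+x. \<integral>\<^sup>+y. g (x, y) \<partial>distr M borel Y \<partial>distr M borel X)"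
    unfolding joint[symmetric] by (subst DY.nn_integral_fst[symmetric]) auto
  also have "\<dots> = (\<integral>\<^sup>+\<omega>. \<integral>\<^sup>+y. g (X \<omega>, y) \<partial>distr M borel Y \<partial>M)"
    by (subst nn_integral_distr) (auto intro!: DY.borel_measurable_nn_integral)
  finally show ?thesis .
qed

section \<open>Convergence in expectation\<close>

locale dfw_problem =
  fixes f :: "nat \<Rightarrow> real^'m^'d \<Rightarrow> real" and F :: "real^'m^'d \<Rightarrow> real"
    and n N :: nat and I :: "nat \<Rightarrow> nat set" and \<mu> L \<delta> :: real and W0 Wstar :: "real^'m^'d"
  assumes mu: "\<mu> > 0" and part: "is_partition I N n" and F_def: "F = sum_fun f {1..n}"
    and f_diff: "\<And>i. i \<in> {1..n} \<Longrightarrow> f i differentiable_on UNIV"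
    and f_lip: "\<And>i. i \<in> {1..n} \<Longrightarrow> \<exists>C. C-lipschitz_on UNIV (grad (f i))"
    and F_conv: "convex_on UNIV F" and F_diff: "F differentiable_on UNIV"
    and F_bdd: "bdd_above (curvature_set F \<mu>)" and C_pos: "curvature_const F \<mu> > 0"
    and L_pos: "L > 0" and F_lip: "\<And>W W'. \<bar>F W - F W'\<bar> \<le> L * trace_norm (W - W')"
    and Wstar: "is_arg_min F (\<lambda>W. W \<in> trace_ball \<mu>) Wstar"
    and delta: "\<delta> > 0" and W0: "W0 \<in> trace_ball \<mu>"
begin

lemma F_differentiable: "F differentiable (at W)"
  using F_diff by (simp add: differentiable_on_def)

lemma grad_F_eq: "grad F W = (\<Sum>i\<in>{1..n}. grad (f i) W)"
  unfolding F_def using f_diff by (intro grad_sum_fun) (auto simp: differentiable_on_def)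

text \<open>Eliminates the workers: disjoint parts covering all indices make the distributed
  iteration a power iteration with the full gradient.\<close>

lemma sum_grad_parts: "(\<Sum>j=1..N. grad (sum_fun f (I j)) W) = grad F W"
proof -
  have dj: "disjoint_family_on I {1..N}" and un: "(\<Union>j\<in>{1..N}. I j) = {1..n}"
    using part by (auto simp: is_partition_def)
  have sub: "I j \<subseteq> {1..n}" if "j \<in> {1..N}" for j using un that by blast
  have "(\<Sum>j=1..N. grad (sum_fun f (I j)) W) = (\<Sum>j=1..N. \<Sum>i\<in>I j. grad (f i) W)"
    using sub f_diff by (intro sum.cong grad_sum_fun) (force simp: differentiable_on_def)+
  also have "\<dots> = (\<Sum>i\<in>(\<Union>j\<in>{1..N}. I j). grad (f i) W)"
    using sub dj finite_subset[OF sub]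
    by (intro sum.UNION_disjoint[symmetric]) (auto simp: disjoint_family_on_def)
  finally show ?thesis unfolding un grad_F_eq .
qed

text \<open>The Lipschitz gradients of the \<open>f i\<close> yield continuity, through which the
  gradient along the run becomes a random variable.\<close>

lemma continuous_on_grad_F: "continuous_on UNIV (grad F)"
proof -
  have "continuous_on UNIV (grad (f i))" if "i \<in> {1..n}" for i
    using f_lip[OF that] lipschitz_on_continuous_on by blast
  hence "continuous_on UNIV (\<lambda>W. \<Sum>i\<in>{1..n}. grad (f i) W)" by (intro continuous_intros) auto
  thus ?thesis by (simp add: grad_F_eq[abs_def])
qed

lemma abs_F_diff_le:
  assumes "W \<in> trace_ball \<mu>"
  shows "\<bar>F W - F Wstar\<bar> \<le> L * (2 * \<mu>)"
proof -
  have "trace_norm (W - Wstar) \<le> 2 * \<mu>"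
    using trace_norm_diff_le[of W Wstar] assms Wstar by (simp add: trace_ball_def is_arg_min_def)
  thus ?thesis using F_lip[of W Wstar] L_pos by (meson mult_left_mono less_imp_le order_trans)
qed

text \<open>The error \<^term>\<open>onorm ((*v) A) - power_ratio A k v\<close> is a function of the gradient and of the
  fresh draw alone, so measurability of the arbitrary choices in the algorithm is never needed.\<close>

lemma dfw_expectation_le:
  fixes M :: "'w measure"
  assumes dfw: "dfw_trace M f n I N \<mu> K W0 W" and K: "\<And>t. K t \<ge> 1"
    and err: "\<And>t. AE \<omega> in M. (\<integral>\<^sup>+v. ennreal (onorm ((*v) (grad F (W t \<omega>)))
        - power_ratio (grad F (W t \<omega>)) (K t) v) \<partial>uniform_sphere)
        \<le> ennreal (\<delta> * curvature_const F \<mu> / (\<mu> * (real t + 2)))"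
    and t: "t \<ge> 1"
  shows "prob_space.expectation M (\<lambda>\<omega>. F (W t \<omega>)) - F Wstar
    \<le> 2 * curvature_const F \<mu> / (real t + 2) * (1 + \<delta>)"
proof -
  define C where "C = curvature_const F \<mu>"
  interpret prob_space M using dfw by (simp add: dfw_trace_def)
  obtain H u v \<gamma> where sub: "\<And>t. subalgebra M (H t)"
    and WH: "\<And>t. W t \<in> borel_measurable (H t)"
    and vH: "\<And>t. v t 0 \<in> borel_measurable (H (Suc t))"
    and v_distr: "\<And>t. distr M borel (v t 0) = uniform_sphere"
    and ind: "\<And>t. indep_set {v t 0 -` B \<inter> space M | B. B \<in> sets borel} (sets (H t))"
    and W_0: "\<And>\<omega>. \<omega> \<in> space M \<Longrightarrow> W 0 \<omega> = W0"
    and power: "\<And>\<omega> t k. \<omega> \<in> space M \<Longrightarrow> k < K t \<Longrightarrow>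
        normalizes (\<Sum>j=1..N. grad (sum_fun f (I j)) (W t \<omega>) *v v t k \<omega>) (u t (Suc k) \<omega>) \<and>
        normalizes (\<Sum>j=1..N. transpose (grad (sum_fun f (I j)) (W t \<omega>)) *v u t (Suc k) \<omega>)
          (v t (Suc k) \<omega>)"
    and W_Suc: "\<And>\<omega> t. \<omega> \<in> space M \<Longrightarrow>
        W (Suc t) \<omega> = fw_step \<mu> (W t \<omega>) (u t (K t) \<omega>) (v t (K t) \<omega>) (\<gamma> t \<omega>)"
    and rule: "(\<forall>\<omega>\<in>space M. \<forall>t. \<gamma> t \<omega> = 2 / (real t + 2)) \<or>
         (\<forall>\<omega>\<in>space M. \<forall>t. is_arg_min
              (\<lambda>g. sum_fun f {1..n} (fw_step \<mu> (W t \<omega>) (u t (K t) \<omega>) (v t (K t) \<omega>) g))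
              (\<lambda>g. g \<in> {0..1}) (\<gamma> t \<omega>))"
    using dfw unfolding dfw_trace_def
  proof (elim conjE exE, goal_cases)
    case (1 H u v \<gamma>)
    show ?case by (rule that[of H v u \<gamma>]) (use 1 in blast)+
  qed
  note rule = rule[folded F_def]
  define G where "G t \<omega> = grad F (W t \<omega>)" for t \<omega>
  have power_G: "normalizes (G t \<omega> *v v t k \<omega>) (u t (Suc k) \<omega>) \<and>
      normalizes (transpose (G t \<omega>) *v u t (Suc k) \<omega>) (v t (Suc k) \<omega>)"
    if "\<omega> \<in> space M" "k < K t" for t k \<omega>
    using power[OF that] unfolding sum_matrix_vector_mult sum_transpose sum_grad_parts G_def .
  \<comment> \<open>At least one iteration is needed here: the vectors with index \<open>K t\<close>
    must be outputs of a normalization.\<close>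
  have unit: "norm (u t (K t) \<omega>) = 1" "norm (v t (K t) \<omega>) = 1" if "\<omega> \<in> space M" for t \<omega>
  proof -
    have "Suc (K t - 1) = K t" "K t - 1 < K t" using K[of t] by auto
    thus "norm (u t (K t) \<omega>) = 1" "norm (v t (K t) \<omega>) = 1"
      using power_G[OF that, of "K t - 1" t] by (simp_all add: normalizes_def)
  qed
  have \<gamma>01: "0 \<le> \<gamma> t \<omega>" "\<gamma> t \<omega> \<le> 1" if "\<omega> \<in> space M" for t \<omega>
    using rule that by (auto simp: is_arg_min_def divide_le_eq)
  have ball: "W t \<omega> \<in> trace_ball \<mu>" if "\<omega> \<in> space M" for t \<omega>
  proof (induction t)
    case (Suc t)
    thus ?case unfolding W_Suc[OF that] using unit[OF that] \<gamma>01[OF that] mu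
      by (intro fw_step_in_trace_ball) auto
  qed (simp add: W_0 that W0)
  \<comment> \<open>Both step-size rules are merged: line search does at least as well as
    \<open>2 / (t + 2)\<close>, which lies in its search interval, so the analysis is carried out
    for that step.\<close>
  have step: "F (W (Suc t) \<omega>) \<le> F (fw_step \<mu> (W t \<omega>) (u t (K t) \<omega>) (v t (K t) \<omega>) (2 / (real t + 2)))"
    if "\<omega> \<in> space M" for t \<omega>
    using rule
  proof
    assume "\<forall>\<omega>\<in>space M. \<forall>t. is_arg_min
              (\<lambda>g. F (fw_step \<mu> (W t \<omega>) (u t (K t) \<omega>) (v t (K t) \<omega>) g)) (\<lambda>g. g \<in> {0..1}) (\<gamma> t \<omega>)"
    moreover have "2 / (real t + 2) \<in> {0..1}" by simp
    ultimately show ?thesis unfolding W_Suc[OF that] using that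
      by (auto simp: is_arg_min_linorder)
  qed (simp add: W_Suc that)
  \<comment> \<open>Depends only on the current iterate and the fresh draw. It dominates the actual
    loss by \<open>power_iteration_ge\<close>, and the truncation makes it integrable from an
    \<open>ennreal\<close> bound.\<close>
  define X where "X t \<omega> = max 0 (onorm ((*v) (G t \<omega>)) - power_ratio (G t \<omega>) (K t) (v t 0 \<omega>))" for t \<omega>
  define h where "h t \<omega> = F (W t \<omega>) - F Wstar" for t \<omega>
  have W_meas [measurable]: "W t \<in> borel_measurable M" for t
    by (rule measurable_from_subalg[OF sub WH])
  have v_meas [measurable]: "v t 0 \<in> borel_measurable M" for t
    by (rule measurable_from_subalg[OF sub vH])
  have F_meas [measurable]: "F \<in> borel_measurable borel"
    by (intro borel_measurable_continuous_onI differentiable_imp_continuous_on F_diff)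
  have G_meas [measurable]: "grad F \<in> borel_measurable borel"
    by (intro borel_measurable_continuous_onI continuous_on_grad_F)
  have g_meas: "(\<lambda>p. ennreal (onorm ((*v) (grad F (fst p))) - power_ratio (grad F (fst p)) k (snd p)))
      \<in> borel_measurable borel" for k
  proof -
    have "(\<lambda>p. (grad F (fst p), snd p :: real^'m)) \<in> borel_measurable borel"
      unfolding borel_prod[symmetric] by measurable
    from measurable_compose[OF this borel_measurable_power_error[of k]]
    show ?thesis by simp
  qed
  have X_meas: "X t \<in> borel_measurable M" for t
  proof -
    have "(\<lambda>\<omega>. (grad F (W t \<omega>), v t 0 \<omega>)) \<in> borel_measurable M"
      unfolding borel_prod[symmetric] by measurable
    from measurable_compose[OF this borel_measurable_power_error[of "K t"]]
    show ?thesis unfolding X_def[abs_def] G_def by simp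
  qed
  have X_int: "integrable M (X t)" "expectation (X t) \<le> \<delta> * C / (\<mu> * (real t + 2))" for t
  proof -
    have "(\<integral>\<^sup>+\<omega>. ennreal (X t \<omega>) \<partial>M) = (\<integral>\<^sup>+\<omega>. ennreal (onorm ((*v) (grad F (W t \<omega>)))
        - power_ratio (grad F (W t \<omega>)) (K t) (v t 0 \<omega>)) \<partial>M)"
      by (simp add: X_def G_def)
    also have "\<dots> = (\<integral>\<^sup>+\<omega>. \<integral>\<^sup>+y. ennreal (onorm ((*v) (grad F (W t \<omega>)))
        - power_ratio (grad F (W t \<omega>)) (K t) y) \<partial>uniform_sphere \<partial>M)"
      using nn_integral_indep_subalgebra[OF sub WH v_meas ind g_meas[of "K t"]] by (simp add: v_distr)
    also have "\<dots> \<le> (\<integral>\<^sup>+\<omega>. ennreal (\<delta> * C / (\<mu> * (real t + 2))) \<partial>M)"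
      unfolding C_def by (rule nn_integral_mono_AE[OF err])
    also have "\<dots> = ennreal (\<delta> * C / (\<mu> * (real t + 2)))" by (simp add: emeasure_space_1)
    finally have le: "(\<integral>\<^sup>+\<omega>. ennreal (X t \<omega>) \<partial>M) \<le> ennreal (\<delta> * C / (\<mu> * (real t + 2)))" .
    thus int: "integrable M (X t)"
      by (intro integrableI_nonneg X_meas) (auto simp: X_def intro: le_less_trans)
    have "ennreal (expectation (X t)) = (\<integral>\<^sup>+\<omega>. ennreal (X t \<omega>) \<partial>M)"
      by (rule nn_integral_eq_integral[symmetric, OF int]) (simp add: X_def)
    with le have "ennreal (expectation (X t)) \<le> ennreal (\<delta> * C / (\<mu> * (real t + 2)))" by simp
    moreover have "0 \<le> \<delta> * C / (\<mu> * (real t + 2))" using delta C_pos mu by (simp add: C_def)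
    ultimately show "expectation (X t) \<le> \<delta> * C / (\<mu> * (real t + 2))"
      by (simp only: ennreal_le_iff)
  qed
  have h_int: "integrable M (h t)" for t
  proof (rule integrable_const_bound)
    show "AE \<omega> in M. norm (h t \<omega>) \<le> L * (2 * \<mu>)"
      using ball abs_F_diff_le by (intro AE_I2) (simp add: h_def)
    show "h t \<in> borel_measurable M" unfolding h_def[abs_def] by measurable
  qed
  have pointwise: "h (Suc t) \<omega> \<le> (1 - 2 / (real t + 2)) * h t \<omega> + (2 / (real t + 2) * \<mu>) * X t \<omega>
      + (2 / (real t + 2))\<^sup>2 / 2 * C" if "\<omega> \<in> space M" for t \<omega>
  proof -
    define g where "g = 2 / (real t + 2)"
    have g: "0 < g" "g \<le> 1" by (simp_all add: g_def)
    have "power_ratio (G t \<omega>) (K t) (v t 0 \<omega>) \<le> u t (K t) \<omega> \<bullet> (G t \<omega> *v v t (K t) \<omega>)"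
      using power_iteration_ge[of "K t" "G t \<omega>" "\<lambda>k. v t k \<omega>" "\<lambda>k. u t k \<omega>"] power_G[OF that] K by blast
    hence "onorm ((*v) (G t \<omega>)) - u t (K t) \<omega> \<bullet> (G t \<omega> *v v t (K t) \<omega>) \<le> X t \<omega>"
      by (simp add: X_def)
    hence "(g * \<mu>) * (onorm ((*v) (G t \<omega>)) - u t (K t) \<omega> \<bullet> (G t \<omega> *v v t (K t) \<omega>)) \<le> (g * \<mu>) * X t \<omega>"
      using g mu by (intro mult_left_mono) auto
    moreover have "F (fw_step \<mu> (W t \<omega>) (u t (K t) \<omega>) (v t (K t) \<omega>) g) - F Wstar \<le> (1 - g) * h t \<omega>
        + g * \<mu> * (onorm ((*v) (G t \<omega>)) - u t (K t) \<omega> \<bullet> (G t \<omega> *v v t (K t) \<omega>)) + g\<^sup>2 / 2 * C"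
      unfolding h_def G_def C_def using unit[OF that] ball[OF that] Wstar g mu
      by (intro fw_step_progress F_conv F_differentiable F_bdd) (auto simp: is_arg_min_def)
    ultimately show ?thesis using step[OF that, of t] unfolding g_def[symmetric] h_def by linarith
  qed
  have rec: "expectation (h (Suc t)) \<le> (1 - 2 / (real t + 2)) * expectation (h t)
      + (2 / (real t + 2))\<^sup>2 / 2 * (C * (1 + \<delta>))" for t
  proof -
    define g where "g = 2 / (real t + 2)"
    have g: "0 < g" "g \<le> 1" by (simp_all add: g_def)
    have "expectation (h (Suc t)) \<le> expectation (\<lambda>\<omega>. (1 - g) * h t \<omega> + (g * \<mu>) * X t \<omega> + g\<^sup>2 / 2 * C)"
    proof (intro integral_mono_AE AE_I2)
      show "integrable M (\<lambda>\<omega>. (1 - g) * h t \<omega> + (g * \<mu>) * X t \<omega> + g\<^sup>2 / 2 * C)"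
        by (intro Bochner_Integration.integrable_add integrable_mult_right h_int X_int(1) integrable_const)
    qed (use pointwise h_int in \<open>simp_all only: g_def\<close>)
    also have "\<dots> = (1 - g) * expectation (h t) + (g * \<mu>) * expectation (X t) + g\<^sup>2 / 2 * C"
      by (simp add: h_int X_int(1) prob_space)
    also have "\<dots> \<le> (1 - g) * expectation (h t) + (g * \<mu>) * (\<delta> * C / (\<mu> * (real t + 2))) + g\<^sup>2 / 2 * C"
      using X_int(2)[of t] g mu by (intro add_mono mult_left_mono) auto
    \<comment> \<open>The factor \<open>\<mu>\<close> cancels and
      \<open>g / (t + 2) = g\<^sup>2 / 2\<close>, which gives the error the exact shape of the
      curvature term.\<close>
    also have "(g * \<mu>) * (\<delta> * C / (\<mu> * (real t + 2))) = g\<^sup>2 / 2 * (C * \<delta>)"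
      using mu by (simp add: g_def power2_eq_square)
    finally show ?thesis unfolding g_def[symmetric] by (simp add: algebra_simps add_divide_distrib)
  qed
  have "expectation (h t) \<le> 2 * (C * (1 + \<delta>)) / (real t + 2)"
    using C_pos delta by (intro fw_recursion rec t) (simp add: C_def)
  moreover have "expectation (h t) = expectation (\<lambda>\<omega>. F (W t \<omega>)) - F Wstar"
  proof -
    have "integrable M (\<lambda>\<omega>. h t \<omega> + F Wstar)" using h_int by simp
    hence "integrable M (\<lambda>\<omega>. F (W t \<omega>))" by (simp add: h_def)
    thus ?thesis by (simp add: h_def[abs_def] prob_space)
  qed
  ultimately show ?thesis by (simp add: C_def mult_ac)
qed

lemma onorm_grad_F_le: "onorm ((*v) (grad F W)) \<le> L"
  using L_pos by (intro onorm_grad_le F_conv F_differentiable F_lip) simp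

lemma dfw_converges_gap_free:
  fixes M :: "'w measure"
  assumes m: "CARD('m) \<ge> 8" and dfw: "dfw_trace M f n I N \<mu> K W0 W"
    and K: "\<And>t. int (K t) \<ge>
      1 + \<lceil>\<mu> * L * (real t + 2) * ln (real CARD('m)) / (\<delta> * curvature_const F \<mu>)\<rceil>"
    and t: "t \<ge> 1"
  shows "prob_space.expectation M (\<lambda>\<omega>. F (W t \<omega>)) - F Wstar
    \<le> 2 * curvature_const F \<mu> / (real t + 2) * (1 + \<delta>)"
proof (rule dfw_expectation_le[OF dfw _ _ t])
  fix t :: nat
  define C where "C = curvature_const F \<mu>"
  define l where "l = ln (real CARD('m))"
  have C: "C > 0" using C_pos by (simp add: C_def)
  \<comment> \<open>The bound on the number of columns enters as \<open>l \<ge> 1\<close>, which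
    absorbs \<open>l + 1\<close> into \<open>2 * l\<close> and cancels the factor 2 in the
    denominator \<open>2 * K t\<close>.\<close>
  have "exp 1 \<le> real CARD('m)" using m exp_le by linarith
  hence l: "l \<ge> 1" unfolding l_def by (subst ln_ge_iff) auto
  define x where "x = \<mu> * L * (real t + 2) * l / (\<delta> * C)"
  have x: "x > 0" using mu L_pos l delta C by (simp add: x_def)
  have "real_of_int (int (K t)) \<ge> real_of_int (1 + \<lceil>x\<rceil>)"
    using K[of t] unfolding x_def l_def C_def by (rule of_int_le_iff[THEN iffD2])
  hence Kx: "real (K t) \<ge> 1 + x" using le_of_int_ceiling[of x] by linarith
  thus K1: "K t \<ge> 1" using x by simp
  have "(l + 1) / (2 * real (K t)) \<le> l / x"
  proof -
    have "(l + 1) * x \<le> (2 * l) * real (K t)" using l x Kx by (intro mult_mono) auto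
    thus ?thesis using x Kx by (simp add: divide_simps mult_ac)
  qed
  hence "L * ((l + 1) / (2 * real (K t))) \<le> L * (l / x)" using L_pos by (intro mult_left_mono) auto
  also have "\<dots> = \<delta> * C / (\<mu> * (real t + 2))"
  proof -
    define T where "T = real t + 2"
    have "T > 0" by (simp add: T_def)
    thus ?thesis unfolding x_def T_def[symmetric]
      using mu L_pos l delta C by (simp add: field_simps)
  qed
  finally have le: "L * ((l + 1) / (2 * real (K t))) \<le> \<delta> * C / (\<mu> * (real t + 2))" .
  show "AE \<omega> in M. (\<integral>\<^sup>+v. ennreal (onorm ((*v) (grad F (W t \<omega>)))
      - power_ratio (grad F (W t \<omega>)) (K t) v) \<partial>uniform_sphere)
      \<le> ennreal (\<delta> * curvature_const F \<mu> / (\<mu> * (real t + 2)))"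
  proof (rule AE_I2)
    fix \<omega>
    have "onorm ((*v) (grad F (W t \<omega>))) * ((l + 1) / (2 * real (K t))) \<le> L * ((l + 1) / (2 * real (K t)))"
      using onorm_grad_F_le l by (intro mult_right_mono) auto
    also note le
    finally show "(\<integral>\<^sup>+v. ennreal (onorm ((*v) (grad F (W t \<omega>)))
        - power_ratio (grad F (W t \<omega>)) (K t) v) \<partial>uniform_sphere)
        \<le> ennreal (\<delta> * curvature_const F \<mu> / (\<mu> * (real t + 2)))"
      unfolding l_def C_def
      by (rule order_trans[OF nn_integral_power_error_le[OF K1] ennreal_leI])
  qed
qed

lemma dfw_converges_gap:
  fixes M :: "'w measure"
  assumes \<beta>: "\<beta> < 1" and dfw: "dfw_trace M f n I N \<mu> K W0 W"
    and gap: "\<And>t. AE \<omega> in M.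
      count (singular_values (grad F (W t \<omega>))) (sing_val (grad F (W t \<omega>)) 1) = 1 \<and>
      sing_val (grad F (W t \<omega>)) 2 / sing_val (grad F (W t \<omega>)) 1 < \<beta>"
    and K: "\<And>t. int (K t) \<ge>
      max (\<lceil>(ln (\<delta> * curvature_const F \<mu>) - ln (real CARD('m) * \<mu> * L * (real t + 2))) / (2 * ln \<beta>)\<rceil> + 1) 1"
    and t: "t \<ge> 1"
  shows "prob_space.expectation M (\<lambda>\<omega>. F (W t \<omega>)) - F Wstar
    \<le> 2 * curvature_const F \<mu> / (real t + 2) * (1 + \<delta>)"
proof (rule dfw_expectation_le[OF dfw _ _ t])
  fix t :: nat
  define C where "C = curvature_const F \<mu>"
  have C: "C > 0" using C_pos by (simp add: C_def)
  interpret prob_space M using dfw by (simp add: dfw_trace_def)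
  show K1: "K t \<ge> 1" using K[of t] by simp
  \<comment> \<open>The ratio of singular values is nonnegative, also when it is a quotient by 0, so
    for \<open>\<beta> \<le> 0\<close> the gap hypothesis would be an almost surely true
    contradiction.\<close>
  have \<beta>0: "\<beta> > 0"
  proof (rule ccontr)
    assume "\<not> \<beta> > 0"
    have "\<not> sing_val A 2 / sing_val A 1 < \<beta>" for A :: "real^'m^'d"
    proof -
      have "0 \<le> sing_val A 2 / sing_val A 1" by (intro divide_nonneg_nonneg sing_val_nonneg) auto
      thus ?thesis using \<open>\<not> \<beta> > 0\<close> by linarith
    qed
    hence "AE \<omega> in M. False" using gap[of 0] by simp
    thus False by simp
  qed
  define D where "D = real CARD('m) * \<mu> * L * (real t + 2)"
  have D: "D > 0" unfolding D_def using mu L_pos by (intro mult_pos_pos) auto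
  define x where "x = (ln (\<delta> * C) - ln D) / (2 * ln \<beta>)"
  have ln\<beta>: "ln \<beta> < 0" using \<beta> \<beta>0 by simp
  have "real_of_int (int (K t)) \<ge> real_of_int (\<lceil>x\<rceil> + 1)"
    using K[of t] unfolding x_def D_def C_def by (intro of_int_le_iff[THEN iffD2]) simp
  hence Kx: "real (K t) - 1 \<ge> x" using le_of_int_ceiling[of x] by linarith
  have pow: "\<beta> ^ (2 * K t - 1) \<le> \<delta> * C / D"
  proof -
    \<comment> \<open>One factor \<open>\<beta>\<close> is given away to reach the even exponent
      \<open>2 * (K t - 1)\<close>, matching the denominator \<open>2 * ln \<beta>\<close> and the
      \<open>+ 1\<close> in the prescribed number of iterations.\<close>
    have "\<beta> ^ (2 * K t - 1) \<le> \<beta> ^ (2 * (K t - 1))"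
      using \<beta> \<beta>0 by (intro power_decreasing) auto
    also have "\<dots> = exp (real (2 * (K t - 1)) * ln \<beta>)"
      using \<beta>0 exp_of_nat_mult[of "2 * (K t - 1)" "ln \<beta>"] by simp
    also have "\<dots> \<le> exp (ln (\<delta> * C / D))"
    proof -
      \<comment> \<open>\<open>ln \<beta>\<close> is negative, so the lower bound on
        \<open>K t\<close> turns into an upper bound.\<close>
      have "(2 * ln \<beta>) * (real (K t) - 1) \<le> (2 * ln \<beta>) * x"
        using Kx ln\<beta> by (intro mult_left_mono_neg) auto
      also have "\<dots> = ln (\<delta> * C / D)"
        using ln\<beta> delta C D by (simp add: x_def ln_div)
      finally show ?thesis using K1 by (simp add: of_nat_diff mult_ac)
    qed
    also have "\<dots> = \<delta> * C / D" using delta C D by simp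
    finally show ?thesis .
  qed
  have "L * (real CARD('m) * \<beta> ^ (2 * K t - 1)) \<le> L * (real CARD('m) * (\<delta> * C / D))"
    using L_pos pow by (intro mult_left_mono) auto
  also have "\<dots> = \<delta> * C / (\<mu> * (real t + 2))"
    using mu L_pos by (simp add: D_def)
  finally have le: "L * (real CARD('m) * \<beta> ^ (2 * K t - 1)) \<le> \<delta> * C / (\<mu> * (real t + 2))" .
  show "AE \<omega> in M. (\<integral>\<^sup>+v. ennreal (onorm ((*v) (grad F (W t \<omega>)))
      - power_ratio (grad F (W t \<omega>)) (K t) v) \<partial>uniform_sphere)
      \<le> ennreal (\<delta> * curvature_const F \<mu> / (\<mu> * (real t + 2)))"
    using gap[of t]
  proof eventually_elim
    case (elim \<omega>)
    have "onorm ((*v) (grad F (W t \<omega>))) * (real CARD('m) * \<beta> ^ (2 * K t - 1))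
        \<le> L * (real CARD('m) * \<beta> ^ (2 * K t - 1))"
      using onorm_grad_F_le \<beta>0 by (intro mult_right_mono) auto
    also note le
    finally show ?case
      unfolding C_def
      by (rule order_trans[OF nn_integral_power_error_gap_le[OF K1 \<beta>0 conjunct1[OF elim] conjunct2[OF elim]] ennreal_leI])
  qed
qed

end

theorem theorem2:
  fixes f :: "nat \<Rightarrow> real^'m^'d \<Rightarrow> real" and F :: "real^'m^'d \<Rightarrow> real"
    and n N :: nat and I :: "nat \<Rightarrow> nat set"
    and \<mu> L \<delta> :: real and W0 Wstar :: "real^'m^'d"
  assumes "n \<ge> 1" and "N \<ge> 1" and "\<mu> > 0" and "is_partition I N n"
    and "F = sum_fun f {1..n}"
    and "\<And>i. i \<in> {1..n} \<Longrightarrow> f i differentiable_on UNIV"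
    and "\<And>i. i \<in> {1..n} \<Longrightarrow> \<exists>C. C-lipschitz_on UNIV (grad (f i))"
    and "convex_on UNIV F" and "F differentiable_on UNIV"
    and "bdd_above (curvature_set F \<mu>)" and "curvature_const F \<mu> > 0"
    and "L > 0" and "\<And>W W'. \<bar>F W - F W'\<bar> \<le> L * trace_norm (W - W')"
    and "is_arg_min F (\<lambda>W. W \<in> trace_ball \<mu>) Wstar"
    and "\<delta> > 0" and "W0 \<in> trace_ball \<mu>"
  shows "(CARD('m) \<ge> 8 \<longrightarrow>
            (\<forall>(M :: 'w measure) K W.
               dfw_trace M f n I N \<mu> K W0 W \<and>
               (\<forall>t. int (K t) \<ge>
                  1 + \<lceil>\<mu> * L * (real t + 2) * ln (real CARD('m)) / (\<delta> * curvature_const F \<mu>)\<rceil>)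
               \<longrightarrow> (\<forall>t\<ge>1. prob_space.expectation M (\<lambda>\<omega>. F (W t \<omega>)) - F Wstar
                        \<le> 2 * curvature_const F \<mu> / (real t + 2) * (1 + \<delta>))))
       \<and> (\<forall>\<beta><1. \<exists>Kt :: nat. \<forall>(M :: 'w measure) K W.
               dfw_trace M f n I N \<mu> K W0 W \<and>
               (\<forall>t. AE \<omega> in M.
                  count (singular_values (grad F (W t \<omega>))) (sing_val (grad F (W t \<omega>)) 1) = 1 \<and>
                  sing_val (grad F (W t \<omega>)) 2 / sing_val (grad F (W t \<omega>)) 1 < \<beta>) \<and>
               (\<forall>t. int (K t) \<ge>
                  max (\<lceil>(ln (\<delta> * curvature_const F \<mu>) - ln (real CARD('m) * \<mu> * L * (real t + 2)))
                        / (2 * ln \<beta>)\<rceil> + 1)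
                      (int Kt))
               \<longrightarrow> (\<forall>t\<ge>1. prob_space.expectation M (\<lambda>\<omega>. F (W t \<omega>)) - F Wstar
                        \<le> 2 * curvature_const F \<mu> / (real t + 2) * (1 + \<delta>)))"
proof -
  interpret dfw_problem f F n N I \<mu> L \<delta> W0 Wstar
    using assms by unfold_locales
  show ?thesis
  proof (intro conjI impI allI)
    fix \<beta> :: real assume "\<beta> < 1"
    thus "\<exists>Kt :: nat. \<forall>(M :: 'w measure) K W.
               dfw_trace M f n I N \<mu> K W0 W \<and>
               (\<forall>t. AE \<omega> in M.
                  count (singular_values (grad F (W t \<omega>))) (sing_val (grad F (W t \<omega>)) 1) = 1 \<and>
                  sing_val (grad F (W t \<omega>)) 2 / sing_val (grad F (W t \<omega>)) 1 < \<beta>) \<and>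
               (\<forall>t. int (K t) \<ge>
                  max (\<lceil>(ln (\<delta> * curvature_const F \<mu>) - ln (real CARD('m) * \<mu> * L * (real t + 2)))
                        / (2 * ln \<beta>)\<rceil> + 1)
                      (int Kt))
               \<longrightarrow> (\<forall>t\<ge>1. prob_space.expectation M (\<lambda>\<omega>. F (W t \<omega>)) - F Wstar
                        \<le> 2 * curvature_const F \<mu> / (real t + 2) * (1 + \<delta>))"
      \<comment> \<open>For large \<open>\<delta>\<close> the ceiling expression is nonpositive; the
        witness 1 then still secures one iteration per epoch.\<close>
      using dfw_converges_gap by (intro exI[of _ 1]) force
  qed (use dfw_converges_gap_free in blast)
qed

end
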